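(* Let $P:[1,\infty)\to\mathbb{R}$ be a tail bound function (defined below) that is convex and non-increasing on $[1,\infty)$ and satisfies $P(1)\le1$. Then for every $\beta\ge1$, the approximation ratio of the kernel $\alpha$-point rounding algorithm with parameter $\beta$ (described below) for GMSSC is at most $\beta\, r(\beta)$, where \[ r(\beta)=e^{1/\beta}\Big(1+\frac1\beta\int_1^\infty P(x)\,e^{\frac{x-1}{\beta}}\,dx\Big).\] In particular, for the bound $P(\gamma)=e^{1-\gamma}/2$ this gives approximation ratio $\beta(2\beta-1)e^{1/\beta}/(2\beta-2)$, which is at most $4.9102$ for $\beta=2.191$; and for the bound $P(\gamma)=e^{-\gamma}(e/2)^{\exp(1-\gamma)}$ the approximation ratio is at most $4.642$ for $\beta=2.0715$.
   Context: GMSSC: input a finite hypergraph $H=(V,E)$, $n=|V|$, each $e\in E$ having a requirement $k_e\in\mathbb{Z}^+$, $k_e\le|e|$. A solution is a bijection $\sigma:V\to\{1,\dots,n\}$; the cover time of $e$ is the smallest $t$ with $|\{v\in e:\sigma(v)\le t\}|\ge k_e$; the objective is the sum of cover times. A tail bound function is a function $P$ such that for every positive integer $k$, every $\gamma\ge1$, and every finite family of independent Bernoulli random variables $Y_v$ with $\mathbb{E}[\sum_vY_v]=\gamma k$, one has $\Pr[\sum_vY_v\le k-1]\le P(\gamma)$. LP relaxation: variables $x_{v,t}\ge0$, $u_{e,t}\ge0$ ($v\in V,e\in E,t\in\{1,\dots,n\}$); minimize $\sum_{e,t}u_{e,t}$ subject to $\sum_vx_{v,t}\le1$ for all $t$,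 and for all $e,t$ and $S\subseteq e$ with $|S|<k_e$: $(k_e-|S|)u_{e,t}+\sum_{v\in e\setminus S}\sum_{t'<t}x_{v,t'}\ge k_e-|S|$. Algorithm with parameter $\beta$: (1) compute an optimal LP solution $x$; (2) for every $v$ and integer $t\ge1$ set $z_{v,t}=\frac{\beta}{t}\sum_{t'\le t}x_{v,t'}$ (with $x_{v,t'}=0$ for $t'>n$); (3) for each $v$ independently draw $\alpha_v$ uniformly from $[0,1]$ and let $\tau(v)$ be the earliest integer $t\ge1$ with $\sum_{t'\le t}z_{v,t'}\ge\alpha_v$; (4) output the ordering of $V$ sorting vertices by $\tau(v)$, ties broken uniformly at random. The approximation ratio means the expected cost of the output divided by the optimum, maximized over instances. *)

theory Defs
  imports "HOL-Probability.Probability"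
begin

definition gmssc_instance :: "'v set \<Rightarrow> 'v set set \<Rightarrow> ('v set \<Rightarrow> nat) \<Rightarrow> bool" where
  "gmssc_instance V E k \<longleftrightarrow>
     finite V \<and> (\<forall>e\<in>E. e \<subseteq> V \<and> 1 \<le> k e \<and> k e \<le> card e)"

text \<open>Orderings are taken extensional, so that there are exactly \<open>fact (card V)\<close> of them and
  the uniform distribution on a set of orderings makes sense.\<close>

definition orderings :: "'v set \<Rightarrow> ('v \<Rightarrow> nat) set" where
  "orderings V = {\<sigma> \<in> V \<rightarrow>\<^sub>E {1..card V}. bij_betw \<sigma> V {1..card V}}"

definition cover_time :: "('v set \<Rightarrow> nat) \<Rightarrow> ('v \<Rightarrow> nat) \<Rightarrow> 'v set \<Rightarrow> nat" where
  "cover_time k \<sigma> e = (LEAST t. k e \<le> card {v \<in> e. \<sigma> v \<le> t})"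

definition gmssc_cost :: "'v set set \<Rightarrow> ('v set \<Rightarrow> nat) \<Rightarrow> ('v \<Rightarrow> nat) \<Rightarrow> nat" where
  "gmssc_cost E k \<sigma> = (\<Sum>e\<in>E. cover_time k \<sigma> e)"

definition gmssc_opt :: "'v set \<Rightarrow> 'v set set \<Rightarrow> ('v set \<Rightarrow> nat) \<Rightarrow> nat" where
  "gmssc_opt V E k = Min (gmssc_cost E k ` orderings V)"

definition lp_feasible ::
  "'v set \<Rightarrow> 'v set set \<Rightarrow> ('v set \<Rightarrow> nat) \<Rightarrow> ('v \<Rightarrow> nat \<Rightarrow> real) \<Rightarrow> ('v set \<Rightarrow> nat \<Rightarrow> real) \<Rightarrow> bool"
where
  "lp_feasible V E k x u \<longleftrightarrow>
     (\<forall>v\<in>V. \<forall>t\<in>{1..card V}. 0 \<le> x v t) \<and>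
     (\<forall>e\<in>E. \<forall>t\<in>{1..card V}. 0 \<le> u e t) \<and>
     (\<forall>t\<in>{1..card V}. (\<Sum>v\<in>V. x v t) \<le> 1) \<and>
     (\<forall>e\<in>E. \<forall>t\<in>{1..card V}. \<forall>S. S \<subseteq> e \<and> card S < k e \<longrightarrow>
        (real (k e) - real (card S)) * u e t + (\<Sum>v\<in>e - S. \<Sum>t'\<in>{1..<t}. x v t')
          \<ge> real (k e) - real (card S))"

definition lp_value :: "'v set \<Rightarrow> 'v set set \<Rightarrow> ('v set \<Rightarrow> nat \<Rightarrow> real) \<Rightarrow> real" where
  "lp_value V E u = (\<Sum>e\<in>E. \<Sum>t\<in>{1..card V}. u e t)"

definition lp_optimal ::
  "'v set \<Rightarrow> 'v set set \<Rightarrow> ('v set \<Rightarrow> nat) \<Rightarrow> ('v \<Rightarrow> nat \<Rightarrow> real) \<Rightarrow> ('v set \<Rightarrow> nat \<Rightarrow> real) \<Rightarrow> bool"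
where
  "lp_optimal V E k x u \<longleftrightarrow>
     lp_feasible V E k x u \<and>
     (\<forall>x' u'. lp_feasible V E k x' u' \<longrightarrow> lp_value V E u \<le> lp_value V E u')"

definition kernel_z :: "'v set \<Rightarrow> real \<Rightarrow> ('v \<Rightarrow> nat \<Rightarrow> real) \<Rightarrow> 'v \<Rightarrow> nat \<Rightarrow> real" where
  "kernel_z V \<beta> x v t = \<beta> / real t * (\<Sum>t'\<in>{1..t}. if t' \<le> card V then x v t' else 0)"

text \<open>If \<open>x v\<close> vanishes identically, the threshold is never reached unless \<open>\<alpha> v = 0\<close>; the
  infimum of the empty set is then \<open>\<infinity>\<close>, which puts \<open>v\<close> behind all vertices with finite value.\<close>

definition alpha_point ::
  "'v set \<Rightarrow> real \<Rightarrow> ('v \<Rightarrow> nat \<Rightarrow> real) \<Rightarrow> ('v \<Rightarrow> real) \<Rightarrow> 'v \<Rightarrow> enat" where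
  "alpha_point V \<beta> x \<alpha> v =
     Inf (enat ` {t. 1 \<le> t \<and> \<alpha> v \<le> (\<Sum>t'\<in>{1..t}. kernel_z V \<beta> x v t')})"

text \<open>The orderings of \<open>V\<close> sorted by \<open>\<tau>\<close>. A uniformly random element of this set is the sorted
  order with ties broken uniformly at random, independently in each class of ties.\<close>

definition sorted_orderings :: "'v set \<Rightarrow> ('v \<Rightarrow> enat) \<Rightarrow> ('v \<Rightarrow> nat) set" where
  "sorted_orderings V \<tau> = {\<sigma> \<in> orderings V. \<forall>v\<in>V. \<forall>w\<in>V. \<tau> v < \<tau> w \<longrightarrow> \<sigma> v < \<sigma> w}"

definition expected_cost ::
  "'v set \<Rightarrow> 'v set set \<Rightarrow> ('v set \<Rightarrow> nat) \<Rightarrow> real \<Rightarrow> ('v \<Rightarrow> nat \<Rightarrow> real) \<Rightarrow> ennreal" where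
  "expected_cost V E k \<beta> x =
     (\<integral>\<^sup>+ \<alpha>. (\<integral>\<^sup>+ \<sigma>. of_nat (gmssc_cost E k \<sigma>)
               \<partial>measure_pmf (pmf_of_set (sorted_orderings V (alpha_point V \<beta> x \<alpha>))))
        \<partial>PiM V (\<lambda>_. uniform_measure lborel {0..1}))"

text \<open>The supremum also ranges over all optimal LP solutions, so a bound on it holds whichever
  optimal solution is computed. For an instance without edges the quotient is \<open>0 / 0 = 0\<close>.
  The type argument is the type from which vertices are taken.\<close>

definition approx_ratio :: "'v itself \<Rightarrow> real \<Rightarrow> ennreal" where
  "approx_ratio (_ :: 'v itself) \<beta> =
     Sup {expected_cost V E k \<beta> x / of_nat (gmssc_opt V E k)
          | (V :: 'v set) E k x u. gmssc_instance V E k \<and> lp_optimal V E k x u}"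

text \<open>The condition only depends on the joint law of the finite family, so it is no restriction
  to take indices in \<open>nat\<close> and a sample space inside \<open>nat \<Rightarrow> bool\<close>.\<close>

definition tail_bound_function :: "(real \<Rightarrow> real) \<Rightarrow> bool" where
  "tail_bound_function P \<longleftrightarrow>
     (\<forall>(k :: nat) (\<gamma> :: real) (M :: (nat \<Rightarrow> bool) measure) (I :: nat set)
         (Y :: nat \<Rightarrow> (nat \<Rightarrow> bool) \<Rightarrow> real).
        1 \<le> k \<and> 1 \<le> \<gamma> \<and> prob_space M \<and> finite I \<and>
        prob_space.indep_vars M (\<lambda>_. borel) Y I \<and>
        (\<forall>i\<in>I. \<forall>\<omega>\<in>space M. Y i \<omega> \<in> {0, 1}) \<and>
        prob_space.expectation M (\<lambda>\<omega>. \<Sum>i\<in>I. Y i \<omega>) = \<gamma> * real k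
        \<longrightarrow> prob_space.prob M {\<omega> \<in> space M. (\<Sum>i\<in>I. Y i \<omega>) \<le> real k - 1} \<le> P \<gamma>)"

text \<open>A tail bound function is nonnegative on \<open>{1..}\<close>, so nothing is lost by the coercion to
  \<open>ennreal\<close>; the integral may be \<open>\<infinity>\<close>.\<close>

definition kernel_r :: "(real \<Rightarrow> real) \<Rightarrow> real \<Rightarrow> ennreal" where
  "kernel_r P \<beta> =
     ennreal (exp (1 / \<beta>)) *
       (1 + ennreal (1 / \<beta>) * (\<integral>\<^sup>+ x\<in>{1..}. ennreal (P x * exp ((x - 1) / \<beta>)) \<partial>lborel))"

definition tail_half_exp :: "real \<Rightarrow> real" where
  "tail_half_exp \<gamma> = exp (1 - \<gamma>) / 2"

definition tail_double_exp :: "real \<Rightarrow> real" where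
  "tail_double_exp \<gamma> = exp (- \<gamma>) * (exp 1 / 2) powr exp (1 - \<gamma>)"

end

theory Submission
  imports Defs
begin

text \<open>Fix an edge \<open>e\<close> with requirement \<open>k\<close>, let \<open>U\<close> be its share of the LP value and \<open>mass v t\<close> the
  accumulated kernel of \<open>v\<close>, so that \<open>v\<close> is reached by time \<open>t\<close> with probability \<open>min 1 (mass v t)\<close>.
  The knapsack cover inequalities are preserved by nonnegative combinations, and the kernel weights
  \<open>1 / s\<close> turn those of the LP into an expected coverage at time \<open>t\<close> of every residual instance of \<open>e\<close>
  by at least \<open>\<beta> ln ((t + 1) / U)\<close> times its residual requirement. As soon as this rate is at least
  \<open>1\<close>, its image under \<open>P\<close> bounds the probability that \<open>e\<close> is not yet covered, and summing over \<open>t\<close>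
  yields \<open>U r(\<beta>)\<close> by the substitution \<open>t = U exp (y / \<beta>)\<close>.
  Let \<open>T\<close> be the first time of rate at least \<open>1\<close> at which \<open>e\<close> is covered. The position of \<open>e\<close> in the
  output is at most \<open>k\<close> plus the number of vertices outside \<open>e\<close> reached by time \<open>T\<close>; those are
  independent of \<open>T\<close>, and by the choice of \<open>T\<close> the number \<open>k\<close> is at most the mass of \<open>e\<close> at time \<open>T\<close>.
  As the total mass at time \<open>T\<close> is at most \<open>\<beta> T\<close>, the expected position is at most \<open>\<beta>\<close> times the
  expectation of \<open>T\<close>.

  For the two explicit bounds, replacing Bernoulli variables by Poisson variables of the same mean
  increases the tail below the mean, and the Poisson tail at mean \<open>\<gamma> k\<close> is estimated by comparing
  logarithmic derivatives in \<open>\<gamma>\<close>, starting from the value at most \<open>1 / 2\<close> at \<open>\<gamma> = 1\<close>.\<close>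

section \<open>Tails of sums of independent Bernoulli variables\<close>



definition poisson_bernoulli_gf :: "real \<Rightarrow> ('a \<Rightarrow> real) \<Rightarrow> 'a set \<Rightarrow> real fps" where
  "poisson_bernoulli_gf \<mu> p I =
     fps_const (exp (- \<mu>)) * fps_exp \<mu> * (\<Prod>i\<in>I. fps_const (1 - p i) + fps_const (p i) * fps_X)"

abbreviation poisson_bernoulli_mass :: "real \<Rightarrow> ('a \<Rightarrow> real) \<Rightarrow> 'a set \<Rightarrow> nat \<Rightarrow> real" where
  "poisson_bernoulli_mass \<mu> p I \<equiv> fps_nth (poisson_bernoulli_gf \<mu> p I)"

text \<open>The mass at \<open>j - 1\<close>, which is \<open>0\<close> for \<open>j = 0\<close>.\<close>

abbreviation poisson_bernoulli_shifted_mass :: "real \<Rightarrow> ('a \<Rightarrow> real) \<Rightarrow> 'a set \<Rightarrow> nat \<Rightarrow> real" where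
  "poisson_bernoulli_shifted_mass \<mu> p I \<equiv> fps_nth (fps_X * poisson_bernoulli_gf \<mu> p I)"

definition poisson_bernoulli_tail :: "real \<Rightarrow> ('a \<Rightarrow> real) \<Rightarrow> 'a set \<Rightarrow> nat \<Rightarrow> real" where
  "poisson_bernoulli_tail \<mu> p I k = (\<Sum>j<k. poisson_bernoulli_mass \<mu> p I j)"

abbreviation bernoulli_tail :: "('a \<Rightarrow> real) \<Rightarrow> 'a set \<Rightarrow> nat \<Rightarrow> real" where
  "bernoulli_tail \<equiv> poisson_bernoulli_tail 0"

definition poisson_tail :: "real \<Rightarrow> nat \<Rightarrow> real" where
  "poisson_tail \<mu> k = exp (- \<mu>) * (\<Sum>j<k. \<mu> ^ j / fact j)"

subsection \<open>Comparison with the Poisson distribution\<close>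

lemma poisson_bernoulli_tail_empty: "poisson_bernoulli_tail \<mu> p {} = poisson_tail \<mu>"
  by (simp add: fun_eq_iff poisson_bernoulli_tail_def poisson_tail_def poisson_bernoulli_gf_def
      sum_distrib_left)

lemma poisson_bernoulli_gf_insert:
  assumes "finite I" "i \<notin> I"
  shows "poisson_bernoulli_gf \<mu> p (insert i I) = poisson_bernoulli_gf \<mu> p I
    + fps_const (p i) * (fps_X * poisson_bernoulli_gf \<mu> p I - poisson_bernoulli_gf \<mu> p I)"
  using assms by (simp add: poisson_bernoulli_gf_def algebra_simps flip: fps_const_sub)

lemma poisson_bernoulli_mass_insert:
  assumes "finite I" "i \<notin> I"
  shows "poisson_bernoulli_mass \<mu> p (insert i I) j = (1 - p i) * poisson_bernoulli_mass \<mu> p I j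
    + p i * poisson_bernoulli_shifted_mass \<mu> p I j"
  unfolding poisson_bernoulli_gf_insert[OF assms] by (simp add: algebra_simps)

lemma poisson_bernoulli_mass_nonneg:
  assumes "finite I" "\<And>i. i \<in> I \<Longrightarrow> p i \<in> {0..1}" "0 \<le> \<mu>"
  shows "0 \<le> poisson_bernoulli_mass \<mu> p I j"
  using assms
proof (induction I arbitrary: j rule: finite_induct)
  case empty
  then show ?case by (simp add: poisson_bernoulli_gf_def)
next
  case (insert i I)
  then show ?case by (simp add: poisson_bernoulli_mass_insert)
qed

lemma poisson_bernoulli_tail_nonneg:
  assumes "finite I" "\<And>i. i \<in> I \<Longrightarrow> p i \<in> {0..1}" "0 \<le> \<mu>"
  shows "0 \<le> poisson_bernoulli_tail \<mu> p I k"
  unfolding poisson_bernoulli_tail_def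
  using assms by (intro sum_nonneg poisson_bernoulli_mass_nonneg)

lemma sum_fps_X_mult_diff:
  fixes f :: "'a :: comm_ring_1 fps"
  shows "(\<Sum>j<k. fps_nth (fps_X * f) j - fps_nth f j) = - fps_nth (fps_X * f) k"
  by (induction k) auto

lemma poisson_bernoulli_tail_insert:
  assumes "finite I" "i \<notin> I"
  shows "poisson_bernoulli_tail \<mu> p (insert i I) k
    = poisson_bernoulli_tail \<mu> p I k - p i * poisson_bernoulli_shifted_mass \<mu> p I k"
proof -
  have "poisson_bernoulli_tail \<mu> p (insert i I) k = poisson_bernoulli_tail \<mu> p I k
     + p i * (\<Sum>j<k. poisson_bernoulli_shifted_mass \<mu> p I j - poisson_bernoulli_mass \<mu> p I j)"
    unfolding poisson_bernoulli_tail_def sum_distrib_left sum.distrib[symmetric]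
    using assms by (intro sum.cong refl) (simp add: poisson_bernoulli_mass_insert algebra_simps)
  then show ?thesis by (simp only: sum_fps_X_mult_diff)
qed

lemma fps_deriv_poisson_bernoulli_gf:
  assumes "finite I"
  shows "fps_deriv (poisson_bernoulli_gf \<mu> p I) = fps_const \<mu> * poisson_bernoulli_gf \<mu> p I
    + (\<Sum>i\<in>I. fps_const (p i) * poisson_bernoulli_gf \<mu> p (I - {i}))"
  using assms
proof (induction I rule: finite_induct)
  case empty
  then show ?case by (simp add: poisson_bernoulli_gf_def mult.left_commute)
next
  case (insert a I)
  let ?G = "poisson_bernoulli_gf \<mu> p"
  let ?b = "fps_const (1 - p a) + fps_const (p a) * fps_X"
  have gf_insert: "?G (insert a J) = ?b * ?G J" if "finite J" "a \<notin> J" for J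
    using that by (simp add: poisson_bernoulli_gf_def mult_ac)
  have "(\<Sum>i\<in>insert a I. fps_const (p i) * ?G (insert a I - {i}))
      = fps_const (p a) * ?G I + (\<Sum>i\<in>I. fps_const (p i) * ?G (insert a (I - {i})))"
    using insert.hyps by (auto simp: insert_Diff_if intro!: sum.cong)
  also have "(\<Sum>i\<in>I. fps_const (p i) * ?G (insert a (I - {i})))
      = ?b * (\<Sum>i\<in>I. fps_const (p i) * ?G (I - {i}))"
    unfolding sum_distrib_left using insert.hyps
    by (intro sum.cong refl) (subst gf_insert, auto simp: mult_ac)
  finally show ?case
    using insert.hyps by (simp add: gf_insert insert.IH algebra_simps)
qed

lemma poisson_bernoulli_mass_le_remove:
  assumes "finite I" "i \<in> I" "0 \<le> p i"
    and shifted_le: "poisson_bernoulli_shifted_mass \<mu> p (I - {i}) j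
      \<le> poisson_bernoulli_mass \<mu> p (I - {i}) j"
  shows "poisson_bernoulli_mass \<mu> p I j \<le> poisson_bernoulli_mass \<mu> p (I - {i}) j"
  using mult_left_mono[OF shifted_le assms(3)] poisson_bernoulli_mass_insert[of "I - {i}" i \<mu> p j]
    assms(1,2)
  by (simp add: insert_absorb algebra_simps)

text \<open>Darroch's rule. Removing the \<open>i\<close>-th variable lowers the mean by at most one, which together with
  the derivative of the generating function allows induction.\<close>

lemma poisson_bernoulli_mass_mono_below_mean:
  assumes "finite I" "\<And>i. i \<in> I \<Longrightarrow> p i \<in> {0..1}" "0 \<le> \<mu>" "real j \<le> \<mu> + sum p I"
  shows "poisson_bernoulli_shifted_mass \<mu> p I j \<le> poisson_bernoulli_mass \<mu> p I j"
  using assms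
proof (induction I arbitrary: j rule: finite_psubset_induct)
  case (psubset I)
  show ?case
  proof (cases j)
    case 0
    then show ?thesis using psubset by (simp add: poisson_bernoulli_mass_nonneg)
  next
    case (Suc m)
    let ?m = "poisson_bernoulli_mass \<mu> p"
    have nonneg: "0 \<le> ?m I m"
      using psubset by (intro poisson_bernoulli_mass_nonneg) auto
    have remove: "?m I m \<le> ?m (I - {i}) m" if i: "i \<in> I" for i
    proof -
      have p_unit: "0 \<le> p i" "p i \<le> 1"
        using psubset.prems(1)[OF i] by auto
      have "sum p I = p i + sum p (I - {i})"
        using psubset.hyps i by (simp add: sum.remove)
      then have "real m \<le> \<mu> + sum p (I - {i})"
        using psubset.prems(3) Suc p_unit by linarith
      then have "poisson_bernoulli_shifted_mass \<mu> p (I - {i}) m \<le> ?m (I - {i}) m"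
        using psubset.prems i by (intro psubset.IH) auto
      with psubset.hyps i p_unit(1) show ?thesis by (rule poisson_bernoulli_mass_le_remove)
    qed
    have "real j * ?m I m \<le> (\<mu> + sum p I) * ?m I m"
      using psubset.prems nonneg by (intro mult_right_mono) auto
    also have "\<dots> = \<mu> * ?m I m + (\<Sum>i\<in>I. p i * ?m I m)"
      by (simp add: sum_distrib_right distrib_right)
    also have "\<dots> \<le> \<mu> * ?m I m + (\<Sum>i\<in>I. p i * ?m (I - {i}) m)"
      using remove psubset.prems by (intro add_left_mono sum_mono mult_left_mono) auto
    also have "\<dots> = fps_nth (fps_deriv (poisson_bernoulli_gf \<mu> p I)) m"
      by (simp add: fps_deriv_poisson_bernoulli_gf psubset.hyps fps_sum_nth del: fps_deriv_nth)
    also have "\<dots> = real j * ?m I j"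
      by (simp add: Suc)
    finally show ?thesis by (simp add: Suc)
  qed
qed

lemma poisson_mass_has_real_derivative:
  "((\<lambda>x. fps_nth (fps_const (exp (- x)) * fps_exp x) j) has_real_derivative
     fps_nth (fps_X * (fps_const (exp (- x)) * fps_exp x)) j
     - fps_nth (fps_const (exp (- x)) * fps_exp x) j) (at x)"
proof (cases j)
  case 0
  then show ?thesis by (auto intro!: derivative_eq_intros)
next
  case (Suc m)
  have "((\<lambda>x. exp (- x) * (x ^ Suc m / fact (Suc m))) has_real_derivative
      exp (- x) * (real (Suc m) * x ^ m / fact (Suc m)) - exp (- x) * (x ^ Suc m / fact (Suc m)))
    (at x)"
    by (rule derivative_eq_intros refl | simp)+
  moreover have "real (Suc m) * x ^ m / fact (Suc m) = x ^ m / fact m"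
    by (simp only: fact_Suc of_nat_mult) simp
  ultimately show ?thesis
    by (simp add: Suc del: fact_Suc of_nat_Suc power_Suc)
qed

lemma poisson_bernoulli_mass_has_real_derivative:
  "((\<lambda>x. poisson_bernoulli_mass x p I j) has_real_derivative
     poisson_bernoulli_shifted_mass x p I j - poisson_bernoulli_mass x p I j) (at x)"
proof -
  define E where "E x = fps_const (exp (- x)) * fps_exp x" for x :: real
  define B where "B = (\<Prod>i\<in>I. fps_const (1 - p i) + fps_const (p i) * fps_X)"
  have gf_eq: "poisson_bernoulli_gf x p I = E x * B" for x
    by (simp add: poisson_bernoulli_gf_def E_def B_def)
  have "((\<lambda>x. \<Sum>i=0..j. fps_nth (E x) i * fps_nth B (j - i)) has_real_derivative
      (\<Sum>i=0..j. (fps_nth (fps_X * E x) i - fps_nth (E x) i) * fps_nth B (j - i))) (at x)"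
    unfolding E_def by (intro DERIV_sum DERIV_cmult_right poisson_mass_has_real_derivative)
  also have "(\<Sum>i=0..j. (fps_nth (fps_X * E x) i - fps_nth (E x) i) * fps_nth B (j - i))
      = fps_nth (fps_X * E x * B) j - fps_nth (E x * B) j"
    unfolding fps_mult_nth[of _ B] by (simp add: left_diff_distrib sum_subtractf)
  finally show ?thesis
    unfolding gf_eq by (simp only: fps_mult_nth[symmetric] mult.assoc)
qed

lemma poisson_bernoulli_tail_has_real_derivative:
  "((\<lambda>x. poisson_bernoulli_tail x p I k) has_real_derivative
     - poisson_bernoulli_shifted_mass x p I k) (at x)"
  unfolding poisson_bernoulli_tail_def sum_fps_X_mult_diff[symmetric]
  by (intro DERIV_sum poisson_bernoulli_mass_has_real_derivative)

text \<open>Moving the mean of one Bernoulli variable gradually into the Poisson variable changes the tail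
  at rate \<open>\<mu> + p i - s\<close> times the increment of the mass function at \<open>k - 1\<close>, which is nonnegative
  by Darroch's rule.\<close>

lemma poisson_bernoulli_tail_insert_le:
  assumes i_fresh: "finite I" "i \<notin> I" and p_unit: "\<And>j. j \<in> insert i I \<Longrightarrow> p j \<in> {0..1}"
    and \<mu>_nonneg: "0 \<le> \<mu>" and mean: "real k \<le> \<mu> + sum p (insert i I)"
  shows "poisson_bernoulli_tail \<mu> p (insert i I) k \<le> poisson_bernoulli_tail (\<mu> + p i) p I k"
proof (cases k)
  case 0
  then show ?thesis by (simp add: poisson_bernoulli_tail_def)
next
  case (Suc c)
  define \<phi> where "\<phi> s = poisson_bernoulli_tail s p I k
      - (\<mu> + p i - s) * poisson_bernoulli_mass s p I c" for s
  have "\<phi> \<mu> \<le> \<phi> (\<mu> + p i)"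
  proof (rule DERIV_nonneg_imp_nondecreasing[of \<mu> "\<mu> + p i" \<phi>])
    show "\<mu> \<le> \<mu> + p i" using p_unit by auto
  next
    fix s assume s_between: "\<mu> \<le> s" "s \<le> \<mu> + p i"
    let ?\<phi>' = "(\<mu> + p i - s)
      * (poisson_bernoulli_mass s p I c - poisson_bernoulli_shifted_mass s p I c)"
    have "(\<phi> has_real_derivative ?\<phi>') (at s)"
      unfolding \<phi>_def Suc
      by (rule derivative_eq_intros poisson_bernoulli_tail_has_real_derivative
          poisson_bernoulli_mass_has_real_derivative refl)+ (simp add: algebra_simps)
    moreover have "real c \<le> s + sum p I"
      using mean i_fresh p_unit[of i] s_between Suc by simp
    then have "poisson_bernoulli_shifted_mass s p I c \<le> poisson_bernoulli_mass s p I c"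
      using i_fresh p_unit \<mu>_nonneg s_between by (intro poisson_bernoulli_mass_mono_below_mean) auto
    then have "0 \<le> ?\<phi>'" using s_between by simp
    ultimately show "\<exists>y. (\<phi> has_real_derivative y) (at s) \<and> 0 \<le> y" by blast
  qed
  then show ?thesis
    by (simp add: \<phi>_def poisson_bernoulli_tail_insert i_fresh Suc)
qed

theorem poisson_bernoulli_tail_le_poisson_tail:
  assumes "finite I" "\<And>i. i \<in> I \<Longrightarrow> p i \<in> {0..1}" "0 \<le> \<mu>" "real k \<le> \<mu> + sum p I"
  shows "poisson_bernoulli_tail \<mu> p I k \<le> poisson_tail (\<mu> + sum p I) k"
  using assms
proof (induction I arbitrary: \<mu> rule: finite_induct)
  case empty
  then show ?case by (simp add: poisson_bernoulli_tail_empty)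
next
  case (insert i I)
  have "poisson_bernoulli_tail \<mu> p (insert i I) k \<le> poisson_bernoulli_tail (\<mu> + p i) p I k"
    using insert by (intro poisson_bernoulli_tail_insert_le) auto
  also have "\<dots> \<le> poisson_tail (\<mu> + p i + sum p I) k"
    using insert.prems insert.hyps by (intro insert.IH) (auto simp: add.assoc)
  finally show ?case using insert.hyps by (simp add: add.assoc)
qed

subsection \<open>Tail bound functions\<close>

lemma bernoulli_tail_insert:
  assumes "finite I" "i \<notin> I"
  shows "bernoulli_tail p (insert i I) (Suc k)
    = p i * bernoulli_tail p I k + (1 - p i) * bernoulli_tail p I (Suc k)"
  using assms
  by (simp add: poisson_bernoulli_tail_insert) (simp add: poisson_bernoulli_tail_def algebra_simps)

lemma (in prob_space) prob_add_indep_bernoulli_less: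
  fixes X S :: "'a \<Rightarrow> real"
  assumes indep: "indep_var borel X borel S" and X_bool: "\<And>\<omega>. \<omega> \<in> space M \<Longrightarrow> X \<omega> \<in> {0, 1}"
  shows "prob {\<omega> \<in> space M. X \<omega> + S \<omega> < z}
    = expectation X * prob {\<omega> \<in> space M. S \<omega> < z - 1}
      + (1 - expectation X) * prob {\<omega> \<in> space M. S \<omega> < z}"
proof -
  have [measurable]: "random_variable borel X" "random_variable borel S"
    using indep_var_rv1[OF indep] indep_var_rv2[OF indep] .
  have "expectation X = expectation (indicator {\<omega> \<in> space M. X \<omega> = 1})"
    using X_bool by (intro Bochner_Integration.integral_cong refl) (auto simp: indicator_def)
  then have prob_one: "prob {\<omega> \<in> space M. X \<omega> = 1} = expectation X" by simp
  have "{\<omega> \<in> space M. X \<omega> = 0} = space M - {\<omega> \<in> space M. X \<omega> = 1}"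
    using X_bool by auto
  then have prob_zero: "prob {\<omega> \<in> space M. X \<omega> = 0} = 1 - expectation X"
    by (simp add: prob_compl prob_one)
  have prob_mult: "prob {\<omega> \<in> space M. X \<omega> = x \<and> S \<omega> < y}
      = prob {\<omega> \<in> space M. X \<omega> = x} * prob {\<omega> \<in> space M. S \<omega> < y}" for x y
    using indep_varD[OF indep, of "{x}" "{..<y}"] by (simp add: vimage_def Int_def conj_commute)
  have "{\<omega> \<in> space M. X \<omega> + S \<omega> < z}
      = {\<omega> \<in> space M. X \<omega> = 1 \<and> S \<omega> < z - 1} \<union> {\<omega> \<in> space M. X \<omega> = 0 \<and> S \<omega> < z}"
    using X_bool by fastforce
  then have "prob {\<omega> \<in> space M. X \<omega> + S \<omega> < z}
      = prob {\<omega> \<in> space M. X \<omega> = 1 \<and> S \<omega> < z - 1} + prob {\<omega> \<in> space M. X \<omega> = 0 \<and> S \<omega> < z}"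
    by (simp only:) (rule finite_measure_Union, auto)
  then show ?thesis by (simp only: prob_mult prob_one prob_zero)
qed

lemma (in prob_space) prob_indep_sum_less_eq_bernoulli_tail:
  fixes Y :: "'b \<Rightarrow> 'a \<Rightarrow> real"
  assumes "finite I" "indep_vars (\<lambda>_. borel) Y I" "\<And>i \<omega>. i \<in> I \<Longrightarrow> \<omega> \<in> space M \<Longrightarrow> Y i \<omega> \<in> {0, 1}"
  shows "prob {\<omega> \<in> space M. (\<Sum>i\<in>I. Y i \<omega>) < real k} = bernoulli_tail (\<lambda>i. expectation (Y i)) I k"
  using assms
proof (induction I arbitrary: k rule: finite_induct)
  case empty
  show ?case
    by (cases k) (simp_all add: poisson_bernoulli_tail_empty poisson_tail_def prob_space
        sum.lessThan_Suc_shift del: sum.lessThan_Suc)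
next
  case (insert a I)
  have nonneg: "0 \<le> (\<Sum>i\<in>J. Y i \<omega>)" if "J \<subseteq> insert a I" "\<omega> \<in> space M" for J \<omega>
    using insert.prems(2) that by (intro sum_nonneg) fastforce
  show ?case
  proof (cases k)
    case 0
    have "{\<omega> \<in> space M. (\<Sum>i\<in>insert a I. Y i \<omega>) < real k} = {}"
      using nonneg[of "insert a I"] by (auto simp: 0 not_less)
    then show ?thesis
      by (simp only:) (simp add: 0 poisson_bernoulli_tail_def)
  next
    case (Suc m)
    have "indep_vars (\<lambda>_. borel) Y I"
      using insert.prems(1) by (rule indep_vars_subset) auto
    then have IH: "prob {\<omega> \<in> space M. (\<Sum>i\<in>I. Y i \<omega>) < real n}
        = bernoulli_tail (\<lambda>i. expectation (Y i)) I n" for n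
      using insert by simp
    have "prob {\<omega> \<in> space M. Y a \<omega> + (\<Sum>i\<in>I. Y i \<omega>) < real k}
        = expectation (Y a) * prob {\<omega> \<in> space M. (\<Sum>i\<in>I. Y i \<omega>) < real k - 1}
          + (1 - expectation (Y a)) * prob {\<omega> \<in> space M. (\<Sum>i\<in>I. Y i \<omega>) < real k}"
      using insert.prems insert.hyps by (intro prob_add_indep_bernoulli_less indep_vars_sum) auto
    then show ?thesis
      using insert.hyps IH[of m] IH[of k] by (simp add: bernoulli_tail_insert Suc add.commute)
  qed
qed

lemma expectation_Pi_pmf_bernoulli:
  assumes "finite I" "i \<in> I" "p i \<in> {0..1}"
  shows "measure_pmf.expectation (Pi_pmf I False (\<lambda>i. bernoulli_pmf (p i))) (\<lambda>\<omega>. of_bool (\<omega> i)) = p i"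
proof -
  let ?D = "Pi_pmf I False (\<lambda>i. bernoulli_pmf (p i))"
  have "measure_pmf.expectation ?D (\<lambda>\<omega>. of_bool (\<omega> i))
      = measure_pmf.expectation (map_pmf (\<lambda>\<omega>. \<omega> i) ?D) (of_bool :: bool \<Rightarrow> real)"
    by simp
  also have "map_pmf (\<lambda>\<omega>. \<omega> i) ?D = bernoulli_pmf (p i)"
    using assms by (simp add: Pi_pmf_component)
  finally show ?thesis using assms by simp
qed

lemma tail_bound_function_bernoulli_tail_nat_le:
  fixes I :: "nat set"
  assumes tail: "tail_bound_function P" and finite_I: "finite I"
    and p_unit: "\<And>i. i \<in> I \<Longrightarrow> p i \<in> {0..1}"
    and k_ge_1: "1 \<le> k" and \<gamma>_ge_1: "1 \<le> \<gamma>" and mean: "sum p I = \<gamma> * real k"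
  shows "bernoulli_tail p I k \<le> P \<gamma>"
proof -
  define D where "D = Pi_pmf I False (\<lambda>i. bernoulli_pmf (p i))"
  define Y :: "nat \<Rightarrow> (nat \<Rightarrow> bool) \<Rightarrow> real" where "Y i \<omega> = of_bool (\<omega> i)" for i \<omega>
  have indep: "prob_space.indep_vars D (\<lambda>_. borel) Y I"
    unfolding D_def Y_def
    by (rule prob_space.indep_vars_compose2[OF measure_pmf.prob_space_axioms
          indep_vars_Pi_pmf[OF finite_I]]) auto
  have expectation_Y: "measure_pmf.expectation D (Y i) = p i" if "i \<in> I" for i
    unfolding D_def Y_def using finite_I that p_unit by (intro expectation_Pi_pmf_bernoulli) auto
  have "integrable D (Y i)" for i
    by (rule measure_pmf.integrable_const_bound[where B = 1]) (auto simp: Y_def)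
  then have expectation_sum: "measure_pmf.expectation D (\<lambda>\<omega>. \<Sum>i\<in>I. Y i \<omega>) = \<gamma> * real k"
    using expectation_Y mean by simp
  have "bernoulli_tail p I k = bernoulli_tail (\<lambda>i. measure_pmf.expectation D (Y i)) I k"
    by (simp add: expectation_Y poisson_bernoulli_tail_def poisson_bernoulli_gf_def)
  also have "\<dots> = measure_pmf.prob D {\<omega> \<in> space D. (\<Sum>i\<in>I. Y i \<omega>) < real k}"
    using finite_I indep
    by (intro measure_pmf.prob_indep_sum_less_eq_bernoulli_tail[symmetric]) (auto simp: Y_def)
  also have "{\<omega> \<in> space D. (\<Sum>i\<in>I. Y i \<omega>) < real k} = {\<omega> \<in> space D. (\<Sum>i\<in>I. Y i \<omega>) \<le> real k - 1}"
    using finite_I by (auto simp: Y_def of_nat_diff_real simp flip: of_nat_Suc)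
  also have "measure_pmf.prob D \<dots> \<le> P \<gamma>"
    using tail[unfolded tail_bound_function_def, rule_format, of k \<gamma> D I Y]
      k_ge_1 \<gamma>_ge_1 finite_I indep expectation_sum measure_pmf.prob_space_axioms[of D]
    by (simp add: Y_def)
  finally show ?thesis .
qed

lemma bernoulli_tail_reindex:
  assumes "inj_on h I"
  shows "bernoulli_tail p (h ` I) k = bernoulli_tail (p \<circ> h) I k"
  using assms by (simp add: poisson_bernoulli_tail_def poisson_bernoulli_gf_def prod.reindex)

theorem tail_bound_function_bernoulli_tail_le:
  assumes "tail_bound_function P" "finite I" "\<And>i. i \<in> I \<Longrightarrow> p i \<in> {0..1}" "1 \<le> k" "1 \<le> \<gamma>"
    and mean: "sum p I = \<gamma> * real k"
  shows "bernoulli_tail p I k \<le> P \<gamma>"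
proof -
  obtain h :: "nat \<Rightarrow> 'a" where "bij_betw h {0..<card I} I"
    using ex_bij_betw_nat_finite[OF assms(2)] by blast
  then have h_bij: "inj_on h {0..<card I}" "h ` {0..<card I} = I" by (auto simp: bij_betw_def)
  have mean_h: "sum (p \<circ> h) {0..<card I} = \<gamma> * real k"
    using mean sum.reindex[OF h_bij(1), of p] h_bij(2) by simp
  have "bernoulli_tail (p \<circ> h) {0..<card I} k \<le> P \<gamma>"
  proof (rule tail_bound_function_bernoulli_tail_nat_le[OF assms(1) _ _ assms(4,5) mean_h])
    show "(p \<circ> h) i \<in> {0..1}" if "i \<in> {0..<card I}" for i
      using assms(3) imageI[OF that, of h] h_bij(2) by simp
  qed auto
  then show ?thesis using bernoulli_tail_reindex[OF h_bij(1), of p k] h_bij(2) by simp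
qed

lemma tail_bound_function_nonneg:
  assumes "tail_bound_function P" "1 \<le> \<gamma>"
  shows "0 \<le> P \<gamma>"
proof -
  define N where "N = nat \<lceil>\<gamma>\<rceil>"
  have N_ge: "\<gamma> \<le> real N" "0 < N" using assms(2) by (auto simp: N_def)
  then have p_unit: "\<gamma> / real N \<in> {0..1}" using assms(2) by (simp add: field_simps)
  have "0 \<le> bernoulli_tail (\<lambda>_. \<gamma> / real N) {..<N} 1"
    using p_unit by (intro poisson_bernoulli_tail_nonneg) auto
  also have "\<dots> \<le> P \<gamma>"
    using p_unit assms N_ge by (intro tail_bound_function_bernoulli_tail_nat_le) auto
  finally show ?thesis .
qed

lemma tail_bound_functionI:
  assumes tail: "\<And>(I :: nat set) p k \<gamma>. finite I \<Longrightarrow> (\<And>i. i \<in> I \<Longrightarrow> p i \<in> {0..1}) \<Longrightarrow> 1 \<le> k \<Longrightarrow>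
      1 \<le> \<gamma> \<Longrightarrow> sum p I = \<gamma> * real k \<Longrightarrow> bernoulli_tail p I k \<le> P \<gamma>"
  shows "tail_bound_function P"
  unfolding tail_bound_function_def
proof (intro allI impI, elim conjE)
  fix k :: nat and \<gamma> :: real and M :: "(nat \<Rightarrow> bool) measure" and I :: "nat set"
    and Y :: "nat \<Rightarrow> (nat \<Rightarrow> bool) \<Rightarrow> real"
  assume k_ge_1: "1 \<le> k" and \<gamma>_ge_1: "1 \<le> \<gamma>" and "prob_space M" and finite_I: "finite I"
    and indep: "prob_space.indep_vars M (\<lambda>_. borel) Y I"
    and Y_bool: "\<forall>i\<in>I. \<forall>\<omega>\<in>space M. Y i \<omega> \<in> {0, 1}"
    and mean: "prob_space.expectation M (\<lambda>\<omega>. \<Sum>i\<in>I. Y i \<omega>) = \<gamma> * real k"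
  interpret prob_space M by fact
  have [measurable]: "random_variable borel (Y i)" if "i \<in> I" for i
    using indep that by (simp add: indep_vars_def)
  have integrable: "integrable M (Y i)" if "i \<in> I" for i
    using Y_bool that by (intro integrable_const_bound[where B = 1]) (fastforce, measurable)
  have "expectation (Y i) \<in> {0..1}" if "i \<in> I" for i
    using Y_bool that integrable by (auto intro!: integral_nonneg_AE integral_le_const) fastforce+
  moreover have "(\<Sum>i\<in>I. expectation (Y i)) = \<gamma> * real k"
    using mean integrable by simp
  ultimately have "bernoulli_tail (\<lambda>i. expectation (Y i)) I k \<le> P \<gamma>"
    using finite_I k_ge_1 \<gamma>_ge_1 by (intro tail)
  moreover have "prob {\<omega> \<in> space M. (\<Sum>i\<in>I. Y i \<omega>) \<le> real k - 1}
      \<le> prob {\<omega> \<in> space M. (\<Sum>i\<in>I. Y i \<omega>) < real k}"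
    by (intro finite_measure_mono) auto
  moreover have "prob {\<omega> \<in> space M. (\<Sum>i\<in>I. Y i \<omega>) < real k}
      = bernoulli_tail (\<lambda>i. expectation (Y i)) I k"
    using finite_I indep Y_bool by (intro prob_indep_sum_less_eq_bernoulli_tail) auto
  ultimately show "prob {\<omega> \<in> space M. (\<Sum>i\<in>I. Y i \<omega>) \<le> real k - 1} \<le> P \<gamma>" by linarith
qed

subsection \<open>The two explicit tail bound functions\<close>

lemma fact_add_le_power_mult_fact:
  fixes k :: nat
  assumes "i < k"
  shows "fact (k + i) \<le> k ^ (2 * i + 1) * fact (k - Suc i)"
  using assms
proof (induction i)
  case 0
  then show ?case by (simp add: fact_reduce)
next
  case (Suc i)
  define m where "m = k - Suc (Suc i)"
  have k_eq: "k = m + Suc (Suc i)" using Suc.prems by (simp add: m_def)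
  then have "k - Suc i = Suc m" by simp
  then have fact_km: "fact (k - Suc i) = Suc m * fact m" by (simp only: fact_Suc of_nat_id)
  have "fact (k + Suc i) = (k + Suc i) * fact (k + i)" by simp
  also have "\<dots> \<le> (k + Suc i) * (k ^ (2 * i + 1) * fact (k - Suc i))"
    using Suc by (intro mult_left_mono) auto
  also have "\<dots> = ((k + Suc i) * Suc m) * (k ^ (2 * i + 1) * fact m)"
    by (simp only: fact_km mult_ac)
  also have "\<dots> \<le> (k * k) * (k ^ (2 * i + 1) * fact m)"
    by (intro mult_right_mono) (simp_all add: k_eq algebra_simps)
  also have "\<dots> = k ^ (2 * Suc i + 1) * fact (k - Suc (Suc i))"
    by (simp add: m_def power_add mult_ac)
  finally show ?case .
qed

lemma sum_power_fact_le_exp: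
  fixes x :: real
  assumes "0 \<le> x"
  shows "(\<Sum>m<n. x ^ m / fact m) \<le> exp x"
proof -
  obtain t where "exp x = (\<Sum>m<n. x ^ m / fact m) + exp t / fact n * x ^ n"
    using Maclaurin_exp_le by blast
  then show ?thesis using assms by simp
qed

lemma poisson_tail_nonneg: "0 \<le> \<mu> \<Longrightarrow> 0 \<le> poisson_tail \<mu> k"
  by (simp add: poisson_tail_def sum_nonneg)

text \<open>The terms with indices \<open>k - 1 - i\<close> and \<open>k + i\<close> of the exponential series are compared.\<close>

lemma poisson_tail_self_le_half: "poisson_tail (real k) k \<le> 1 / 2"
proof -
  define a where "a j = real k ^ j / fact j" for j
  have reflect: "a (k - Suc i) \<le> a (k + i)" if "i < k" for i
  proof -
    have "real (fact (k + i)) \<le> real (k ^ (2 * i + 1) * fact (k - Suc i))"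
      using fact_add_le_power_mult_fact[OF that] by (simp only: of_nat_le_iff)
    then have "real k ^ (k - Suc i) * fact (k + i)
        \<le> real k ^ (k - Suc i) * (real k ^ (2 * i + 1) * fact (k - Suc i))"
      by (intro mult_left_mono) simp_all
    also have "\<dots> = real k ^ (k + i) * fact (k - Suc i)"
      using that by (simp add: add.commute flip: power_add power_Suc mult.assoc)
    finally show ?thesis by (simp add: a_def divide_simps mult.commute)
  qed
  have "2 * (\<Sum>j<k. a j) = (\<Sum>j<k. a j) + (\<Sum>i<k. a (k - Suc i))"
    by (simp add: sum.nat_diff_reindex)
  also have "\<dots> \<le> (\<Sum>j<k. a j) + (\<Sum>i<k. a (k + i))"
    using reflect by (intro add_left_mono sum_mono) auto
  also have "\<dots> = (\<Sum>j<k + k. a j)"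
    using sum.atLeastLessThan_concat[of 0 k "k + k" a] sum.shift_bounds_nat_ivl[of a 0 k k]
    by (simp add: lessThan_atLeast0 add.commute)
  also have "\<dots> \<le> exp (real k)"
    unfolding a_def by (rule sum_power_fact_le_exp) simp
  finally show ?thesis by (simp add: a_def poisson_tail_def exp_minus field_simps)
qed

lemma exp_mult_fact_le_power:
  assumes "3 \<le> k"
  shows "2 / 3 * exp (real k) * fact (k - 1) \<le> real k ^ k"
  using assms
proof (induction k rule: dec_induct)
  case base
  have "exp (1 :: real) ^ 3 \<le> 2.72 ^ 3"
    using e_less_272 by (intro power_mono) auto
  then have "exp (3 :: real) \<le> 2.72 ^ 3"
    by (simp flip: exp_of_nat_mult)
  then show ?case by (simp add: fact_numeral eval_nat_numeral)
next
  case (step k)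
  define x where "x = real (Suc k) / real k"
  have k_pos: "0 < real k" using step by simp
  have "1 - 1 / x \<le> ln x"
    using ln_le_minus_one[of "1 / x"] k_pos by (simp add: x_def ln_div)
  then have "1 \<le> real (Suc k) * ln x"
    using k_pos by (simp add: x_def field_simps)
  then have "exp 1 \<le> exp (real (Suc k) * ln x)" by simp
  also have "\<dots> = x ^ Suc k"
    using k_pos by (simp add: exp_of_nat_mult x_def del: of_nat_Suc)
  finally have exp_1_le: "exp 1 \<le> x ^ Suc k" .
  have fact_k: "fact k = real k * fact (k - 1)"
    using step by (simp add: fact_reduce)
  have "2 / 3 * exp (real (Suc k)) * fact k = (2 / 3 * exp (real k) * fact (k - 1)) * (exp 1 * real k)"
    unfolding fact_k by (simp add: exp_add)
  also have "\<dots> \<le> real k ^ k * (x ^ Suc k * real k)"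
    using step.IH exp_1_le k_pos by (intro mult_mono) (auto simp: x_def)
  also have "\<dots> = real (Suc k) ^ Suc k"
    using k_pos by (simp add: x_def power_divide del: of_nat_Suc)
  finally show ?case by simp
qed

lemma sum_power_fact_mult_power_le:
  fixes x y :: real
  assumes "0 \<le> x" "x \<le> y"
  shows "(\<Sum>j\<le>c. y ^ j / fact j) * x ^ c \<le> (\<Sum>j\<le>c. x ^ j / fact j) * y ^ c"
  unfolding sum_distrib_right
proof (rule sum_mono)
  fix j assume "j \<in> {..c}"
  then have power_split: "z ^ c = z ^ j * z ^ (c - j)" for z :: real
    by (simp flip: power_add)
  have "(y ^ j * x ^ j) * x ^ (c - j) \<le> (y ^ j * x ^ j) * y ^ (c - j)"
    using assms by (intro mult_left_mono power_mono) auto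
  then have "y ^ j * x ^ c \<le> x ^ j * y ^ c" by (simp add: power_split mult_ac)
  then show "y ^ j / fact j * x ^ c \<le> x ^ j / fact j * y ^ c"
    by (simp add: divide_right_mono)
qed

text \<open>The hazard rate of the Poisson distribution, i.e. the ratio of its mass at \<open>c\<close> to its tail,
  increases with the mean, so it suffices to bound it at the mean \<open>Suc c\<close>.\<close>

lemma poisson_tail_le_mass:
  assumes c_ge_1: "1 \<le> c" and x_ge: "real (Suc c) \<le> x"
  shows "4 / 3 * poisson_tail x (Suc c) \<le> real (Suc c) * (exp (- x) * x ^ c / fact c)"
proof -
  define k where "k = real (Suc c)"
  define s where "s y = (\<Sum>j\<le>c. y ^ j / fact j)" for y :: real
  have k_bounds: "0 < k" "k \<le> x" using x_ge by (simp_all add: k_def)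
  have "4 / 3 * s k \<le> k * k ^ c / fact c"
  proof (cases "c = 1")
    case True
    then show ?thesis by (simp add: s_def k_def)
  next
    case False
    have "exp (- k) * s k \<le> 1 / 2"
      using poisson_tail_self_le_half[of "Suc c"]
      by (simp add: poisson_tail_def s_def k_def lessThan_Suc_atMost del: sum.lessThan_Suc)
    then have "s k \<le> exp k / 2" by (simp add: exp_minus field_simps)
    moreover have "2 / 3 * exp k * fact c \<le> k ^ Suc c"
      using exp_mult_fact_le_power[of "Suc c"] c_ge_1 False by (simp add: k_def)
    then have "2 / 3 * exp k \<le> k * k ^ c / fact c" by (simp add: field_simps)
    ultimately show ?thesis by linarith
  qed
  then have "4 / 3 * s k * x ^ c \<le> k * k ^ c / fact c * x ^ c"
    using k_bounds by (intro mult_right_mono) auto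
  moreover have "s x * k ^ c \<le> s k * x ^ c"
    unfolding s_def using k_bounds by (intro sum_power_fact_mult_power_le) auto
  ultimately have "(4 / 3 * s x) * k ^ c \<le> (k * x ^ c / fact c) * k ^ c"
    by (simp add: mult_ac)
  then have "4 / 3 * s x \<le> k * x ^ c / fact c"
    by (rule mult_right_le_imp_le) (use k_bounds in simp)
  from mult_left_mono[OF this, of "exp (- x)"] show ?thesis
    by (simp add: poisson_tail_def s_def k_def lessThan_Suc_atMost mult_ac del: sum.lessThan_Suc)
qed

lemma poisson_tail_has_real_derivative [derivative_intros]:
  assumes "(f has_real_derivative f') (at x within S)"
  shows "((\<lambda>x. poisson_tail (f x) (Suc c)) has_real_derivative
     - (exp (- f x) * f x ^ c / fact c) * f') (at x within S)"
proof (rule DERIV_chain2[OF _ assms])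
  show "((\<lambda>x. poisson_tail x (Suc c)) has_real_derivative - (exp (- y) * y ^ c / fact c)) (at y)" for y
    using poisson_bernoulli_tail_has_real_derivative[of "\<lambda>_. 0" "{}" "Suc c" y]
    by (simp add: poisson_bernoulli_tail_empty poisson_bernoulli_gf_def)
qed

lemma tail_double_exp_eq: "tail_double_exp \<gamma> = exp ((1 - ln 2) * exp (1 - \<gamma>) - \<gamma>)"
  by (simp add: tail_double_exp_def powr_def ln_div mult.commute flip: exp_add)

theorem poisson_tail_le_tail_double_exp:
  assumes k_ge_1: "1 \<le> k" and \<gamma>_ge_1: "1 \<le> \<gamma>"
  shows "poisson_tail (\<gamma> * real k) k \<le> tail_double_exp \<gamma>"
proof (cases "k = 1")
  case True
  have "0 \<le> (1 - ln 2) * exp (1 - \<gamma>)"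
    using ln_2_less_1 by simp
  then show ?thesis
    by (simp add: True poisson_tail_def tail_double_exp_eq)
next
  case False
  then obtain c where k_eq: "k = Suc c" "1 \<le> c" using k_ge_1 by (cases k) auto
  define h where "h g = g - (1 - ln 2) * exp (1 - g)" for g :: real
  define \<Phi> where "\<Phi> g = poisson_tail (g * real k) k * exp (h g)" for g
  have "\<Phi> \<gamma> \<le> \<Phi> 1"
  proof (rule DERIV_nonpos_imp_nonincreasing[OF \<gamma>_ge_1])
    fix g :: real assume g_between: "1 \<le> g" "g \<le> \<gamma>"
    let ?x = "g * real k"
    let ?\<Phi>' = "exp (h g) * ((1 + (1 - ln 2) * exp (1 - g)) * poisson_tail ?x k
        - real k * (exp (- ?x) * ?x ^ c / fact c))"
    have deriv: "(\<Phi> has_real_derivative ?\<Phi>') (at g)"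
      unfolding \<Phi>_def h_def k_eq by (rule derivative_eq_intros refl)+ (simp add: algebra_simps)
    have "(1 - ln 2) * exp (1 - g) \<le> (1 - ln 2) * 1"
      using g_between ln_2_less_1 by (intro mult_left_mono) auto
    then have "1 + (1 - ln 2) * exp (1 - g) \<le> 4 / 3"
      using ln2_ge_two_thirds by simp
    then have "(1 + (1 - ln 2) * exp (1 - g)) * poisson_tail ?x k \<le> 4 / 3 * poisson_tail ?x k"
      using g_between by (intro mult_right_mono poisson_tail_nonneg) auto
    also have "\<dots> \<le> real k * (exp (- ?x) * ?x ^ c / fact c)"
      using poisson_tail_le_mass[OF k_eq(2), of ?x] g_between k_eq by simp
    finally have "?\<Phi>' \<le> 0" by (simp add: mult_nonneg_nonpos)
    with deriv show "\<exists>y. (\<Phi> has_real_derivative y) (at g) \<and> y \<le> 0" by blast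
  qed
  also have "\<Phi> 1 \<le> 1"
    using poisson_tail_self_le_half[of k] by (simp add: \<Phi>_def h_def)
  finally have "poisson_tail (\<gamma> * real k) k \<le> exp (- h \<gamma>)"
    by (simp add: \<Phi>_def exp_minus field_simps)
  then show ?thesis by (simp add: tail_double_exp_eq h_def)
qed

theorem tail_bound_function_tail_double_exp: "tail_bound_function tail_double_exp"
proof (rule tail_bound_functionI)
  fix I :: "nat set" and p and k :: nat and \<gamma> :: real
  assume means: "finite I" "\<And>i. i \<in> I \<Longrightarrow> p i \<in> {0..1}" and k_ge_1: "1 \<le> k" and \<gamma>_ge_1: "1 \<le> \<gamma>"
    and mean: "sum p I = \<gamma> * real k"
  have "real k \<le> sum p I" using mult_right_mono[OF \<gamma>_ge_1, of "real k"] by (simp add: mean)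
  then have "bernoulli_tail p I k \<le> poisson_tail (sum p I) k"
    using poisson_bernoulli_tail_le_poisson_tail[OF means, where \<mu> = 0] by simp
  also have "\<dots> \<le> tail_double_exp \<gamma>"
    unfolding mean using k_ge_1 \<gamma>_ge_1 by (rule poisson_tail_le_tail_double_exp)
  finally show "bernoulli_tail p I k \<le> tail_double_exp \<gamma>" .
qed

lemma tail_double_exp_le_tail_half_exp:
  assumes "1 \<le> \<gamma>"
  shows "tail_double_exp \<gamma> \<le> tail_half_exp \<gamma>"
proof -
  have "(1 - ln 2) * exp (1 - \<gamma>) \<le> (1 - ln 2) * 1"
    using assms ln_2_less_1 by (intro mult_left_mono) auto
  then have "tail_double_exp \<gamma> \<le> exp ((1 - \<gamma>) - ln 2)"
    by (simp add: tail_double_exp_eq)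
  also have "\<dots> = tail_half_exp \<gamma>"
    by (subst exp_diff) (simp add: tail_half_exp_def)
  finally show ?thesis .
qed

lemma tail_bound_function_mono:
  assumes "tail_bound_function P" "\<And>\<gamma>. 1 \<le> \<gamma> \<Longrightarrow> P \<gamma> \<le> Q \<gamma>"
  shows "tail_bound_function Q"
  using assms unfolding tail_bound_function_def by (meson order_trans)

theorem tail_bound_function_tail_half_exp: "tail_bound_function tail_half_exp"
  using tail_bound_function_tail_double_exp tail_double_exp_le_tail_half_exp
  by (rule tail_bound_function_mono)

lemma antimono_on_tail_double_exp: "antimono_on {1..} tail_double_exp"
  using ln_2_less_1 by (auto simp: tail_double_exp_eq intro!: monotone_onI diff_mono mult_left_mono)

lemma antimono_on_tail_half_exp: "antimono_on {1..} tail_half_exp"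
  by (auto simp: tail_half_exp_def intro!: monotone_onI)

section \<open>Orderings\<close>

lemma orderings_bij_betw: "\<sigma> \<in> orderings V \<Longrightarrow> bij_betw \<sigma> V {1..card V}"
  by (simp add: orderings_def)

lemma finite_orderings: "finite V \<Longrightarrow> finite (orderings V)"
  unfolding orderings_def
  by (rule finite_subset[of _ "V \<rightarrow>\<^sub>E {1..card V}"]) (auto intro: finite_PiE)

lemma orderings_range: "\<sigma> \<in> orderings V \<Longrightarrow> v \<in> V \<Longrightarrow> \<sigma> v \<in> {1..card V}"
  using orderings_bij_betw bij_betwE by blast

lemma orderings_card_prefix:
  assumes "\<sigma> \<in> orderings V" "m \<le> card V"
  shows "card {v \<in> V. \<sigma> v \<le> m} = m"
proof -
  have bij_\<sigma>: "bij_betw \<sigma> V {1..card V}" using assms(1) by (rule orderings_bij_betw)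
  have "{1..m} \<subseteq> \<sigma> ` V" using bij_\<sigma> assms(2) by (auto simp: bij_betw_def)
  then have "\<sigma> ` {v \<in> V. \<sigma> v \<le> m} = {1..m}"
    using orderings_range[OF assms(1)] by fastforce
  moreover have "inj_on \<sigma> {v \<in> V. \<sigma> v \<le> m}"
    by (rule inj_on_subset[OF bij_betw_imp_inj_on[OF bij_\<sigma>]]) auto
  ultimately show ?thesis
    using card_image[of \<sigma> "{v \<in> V. \<sigma> v \<le> m}"] by simp
qed

lemma sorted_orderings_nonempty:
  assumes "finite V"
  shows "sorted_orderings V \<tau> \<noteq> {}"
proof -
  obtain ys where ys_V: "set ys = V" "distinct ys"
    using finite_distinct_list[OF assms] by blast
  define xs where "xs = sort_key \<tau> ys"
  define index where "index = inv_into {..<length xs} ((!) xs)"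
  define \<sigma> where "\<sigma> = restrict (Suc \<circ> index) V"
  have xs_sorted: "set xs = V" "distinct xs" "sorted (map \<tau> xs)"
    using ys_V by (simp_all add: xs_def)
  have length_xs: "length xs = card V" using xs_sorted distinct_card by fastforce
  have bij_nth: "bij_betw ((!) xs) {..<length xs} V"
    using xs_sorted by (intro bij_betw_nth) auto
  have index_nth: "index v < length xs" "xs ! index v = v" if "v \<in> V" for v
    using bij_betwE[OF bij_betw_inv_into[OF bij_nth]] bij_betw_inv_into_right[OF bij_nth that] that
    by (auto simp: index_def)
  have "bij_betw (Suc \<circ> index) V {1..card V}"
    using bij_betw_inv_into[OF bij_nth]
    by (intro bij_betw_trans[where B = "{..<length xs}"])
      (auto simp: index_def length_xs bij_betw_def image_Suc_lessThan)
  then have bij_\<sigma>: "bij_betw \<sigma> V {1..card V}"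
    by (simp add: \<sigma>_def)
  moreover have "\<sigma> v < \<sigma> w" if "v \<in> V" "w \<in> V" "\<tau> v < \<tau> w" for v w
  proof (rule ccontr)
    assume "\<not> \<sigma> v < \<sigma> w"
    then have "\<tau> (xs ! index w) \<le> \<tau> (xs ! index v)"
      using sorted_nth_mono[OF xs_sorted(3), of "index w" "index v"] index_nth that
      by (simp add: \<sigma>_def)
    then show False using that index_nth by simp
  qed
  ultimately have "\<sigma> \<in> sorted_orderings V \<tau>"
    using bij_betwE[OF bij_\<sigma>] by (auto simp: sorted_orderings_def orderings_def \<sigma>_def)
  then show ?thesis by blast
qed

lemma finite_sorted_orderings: "finite V \<Longrightarrow> finite (sorted_orderings V \<tau>)"
  by (rule finite_subset[OF _ finite_orderings]) (auto simp: sorted_orderings_def)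

lemma cover_time_le: "k e \<le> card {v \<in> e. \<sigma> v \<le> t} \<Longrightarrow> cover_time k \<sigma> e \<le> t"
  unfolding cover_time_def by (rule Least_le)

lemma orderings_edge_prefix: "\<sigma> \<in> orderings V \<Longrightarrow> e \<subseteq> V \<Longrightarrow> {v \<in> e. \<sigma> v \<le> card V} = e"
  using orderings_range by fastforce

lemma cover_time_le_card:
  "\<sigma> \<in> orderings V \<Longrightarrow> e \<subseteq> V \<Longrightarrow> k e \<le> card e \<Longrightarrow> cover_time k \<sigma> e \<le> card V"
  by (simp add: cover_time_le orderings_edge_prefix)

lemma card_cover_time_ge:
  assumes "\<sigma> \<in> orderings V" "e \<subseteq> V" "k e \<le> card e"
  shows "k e \<le> card {v \<in> e. \<sigma> v \<le> cover_time k \<sigma> e}"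
  unfolding cover_time_def
  by (rule LeastI[of _ "card V"]) (use assms in \<open>simp add: orderings_edge_prefix\<close>)

lemma sorted_orderings_prefix:
  assumes \<sigma>_sorted: "\<sigma> \<in> sorted_orderings V \<tau>" and v_prefix: "v \<in> V" "\<sigma> v \<le> card {w \<in> V. \<tau> w \<le> t}"
  shows "\<tau> v \<le> t"
proof (rule ccontr)
  assume "\<not> \<tau> v \<le> t"
  define Q where "Q = {w \<in> V. \<tau> w \<le> t}"
  have \<sigma>_ordering: "\<sigma> \<in> orderings V" using \<sigma>_sorted by (simp add: sorted_orderings_def)
  have "\<sigma> w < \<sigma> v" if "w \<in> Q" for w
    using \<sigma>_sorted v_prefix(1) that \<open>\<not> \<tau> v \<le> t\<close> by (auto simp: sorted_orderings_def Q_def)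
  then have "\<sigma> ` Q \<subseteq> {1..<\<sigma> v}"
    using orderings_range[OF \<sigma>_ordering] by (auto simp: Q_def)
  then have "card (\<sigma> ` Q) \<le> card {1..<\<sigma> v}" by (intro card_mono) auto
  moreover have "inj_on \<sigma> Q"
    using bij_betw_imp_inj_on[OF orderings_bij_betw[OF \<sigma>_ordering]]
    by (rule inj_on_subset) (auto simp: Q_def)
  ultimately have "card Q \<le> \<sigma> v - 1" by (simp add: card_image)
  then show False
    using v_prefix(2) orderings_range[OF \<sigma>_ordering v_prefix(1)] unfolding Q_def atLeastAtMost_iff
    by linarith
qed

lemma sorted_cover_time_le:
  assumes finite_V: "finite V" and e_subset: "e \<subseteq> V" and \<sigma>_sorted: "\<sigma> \<in> sorted_orderings V \<tau>"
    and reached: "k e \<le> card {v \<in> e. \<tau> v \<le> t}"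
  shows "cover_time k \<sigma> e \<le> k e + card {w \<in> V - e. \<tau> w \<le> t}"
proof (rule cover_time_le)
  let ?m = "k e + card {w \<in> V - e. \<tau> w \<le> t}"
  have finite_e: "finite e" using e_subset finite_V by (rule finite_subset)
  have "card {w \<in> V. \<tau> w \<le> t} = card {v \<in> e. \<tau> v \<le> t} + card {w \<in> V - e. \<tau> w \<le> t}"
    using finite_V finite_e e_subset
    by (subst card_Un_disjoint[symmetric]) (auto intro!: arg_cong[where f = card])
  then have prefix_le: "?m \<le> card {w \<in> V. \<tau> w \<le> t}" using reached by simp
  also have "\<dots> \<le> card V" using finite_V by (intro card_mono) auto
  finally have "?m = card {v \<in> V. \<sigma> v \<le> ?m}"
    using \<sigma>_sorted by (intro orderings_card_prefix[symmetric]) (auto simp: sorted_orderings_def)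
  also have "\<dots> \<le> card ({v \<in> e. \<sigma> v \<le> ?m} \<union> {w \<in> V - e. \<tau> w \<le> t})"
    using finite_V finite_e prefix_le sorted_orderings_prefix[OF \<sigma>_sorted, of _ t]
    by (intro card_mono) auto
  also have "\<dots> \<le> card {v \<in> e. \<sigma> v \<le> ?m} + card {w \<in> V - e. \<tau> w \<le> t}"
    by (rule card_Un_le)
  finally show "k e \<le> card {v \<in> e. \<sigma> v \<le> ?m}" by simp
qed

section \<open>Knapsack cover inequalities\<close>

definition knapsack_cover :: "('v \<Rightarrow> real) \<Rightarrow> 'v set \<Rightarrow> nat \<Rightarrow> real \<Rightarrow> bool" where
  "knapsack_cover z e r g \<longleftrightarrow>
     (\<forall>S\<subseteq>e. card S < r \<longrightarrow> (real r - real (card S)) * g \<le> sum z (e - S))"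

lemma knapsack_cover_cong:
  "(\<And>v. v \<in> e \<Longrightarrow> z v = z' v) \<Longrightarrow> knapsack_cover z e r g = knapsack_cover z' e r g"
  unfolding knapsack_cover_def
  by (intro all_cong1 imp_cong refl) (auto intro!: arg_cong2[where f = "(\<le>)"] sum.cong)

lemma knapsack_cover_antimono:
  assumes "knapsack_cover z e r g" "g' \<le> g"
  shows "knapsack_cover z e r g'"
  unfolding knapsack_cover_def
proof (intro allI impI)
  fix S assume S_admissible: "S \<subseteq> e" "card S < r"
  then have "(real r - real (card S)) * g' \<le> (real r - real (card S)) * g"
    using assms(2) by (intro mult_left_mono) auto
  also have "\<dots> \<le> sum z (e - S)" using assms(1) S_admissible by (simp add: knapsack_cover_def)
  finally show "(real r - real (card S)) * g' \<le> sum z (e - S)" .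
qed

lemma knapsack_cover_0: "(\<And>v. v \<in> e \<Longrightarrow> 0 \<le> z v) \<Longrightarrow> knapsack_cover z e r 0"
  by (auto simp: knapsack_cover_def intro: sum_nonneg)

lemma knapsack_cover_sum:
  assumes cover: "\<And>s. s \<in> A \<Longrightarrow> knapsack_cover (z s) e r (g s)" and c_nonneg: "\<And>s. s \<in> A \<Longrightarrow> 0 \<le> c s"
  shows "knapsack_cover (\<lambda>v. \<Sum>s\<in>A. c s * z s v) e r (\<Sum>s\<in>A. c s * g s)"
  unfolding knapsack_cover_def
proof (intro allI impI)
  fix S assume S_admissible: "S \<subseteq> e" "card S < r"
  have "(real r - real (card S)) * (\<Sum>s\<in>A. c s * g s)
      = (\<Sum>s\<in>A. c s * ((real r - real (card S)) * g s))"
    by (simp add: sum_distrib_left mult_ac)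
  also have "\<dots> \<le> (\<Sum>s\<in>A. c s * sum (z s) (e - S))"
    using cover c_nonneg S_admissible
    by (intro sum_mono mult_left_mono) (auto simp: knapsack_cover_def)
  also have "\<dots> = (\<Sum>v\<in>e - S. \<Sum>s\<in>A. c s * z s v)"
    unfolding sum_distrib_left by (rule sum.swap)
  finally show "(real r - real (card S)) * (\<Sum>s\<in>A. c s * g s) \<le> (\<Sum>v\<in>e - S. \<Sum>s\<in>A. c s * z s v)" .
qed

lemma knapsack_cover_of_bool:
  assumes finite_e: "finite e" and r_le: "r \<le> card {v \<in> e. Q v}"
  shows "knapsack_cover (\<lambda>v. of_bool (Q v)) e r 1"
  unfolding knapsack_cover_def
proof (intro allI impI)
  fix S assume "S \<subseteq> e"
  then have "finite S" using finite_e by (rule finite_subset)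
  then have "r \<le> card (S \<union> {v \<in> e - S. Q v})"
    using finite_e by (intro order_trans[OF r_le] card_mono) auto
  also have "\<dots> \<le> card S + card {v \<in> e - S. Q v}" by (rule card_Un_le)
  finally show "(real r - real (card S)) * 1 \<le> (\<Sum>v\<in>e - S. of_bool (Q v))"
    using finite_e by (simp add: Int_def)
qed

text \<open>Vertices of mass at least \<open>1\<close> are reached with certainty; the inequality for the set \<open>S\<close> of
  these vertices involves no truncation.\<close>

lemma knapsack_cover_residual:
  assumes cover: "knapsack_cover z e r g" and S_eq: "S = {v \<in> e. 1 \<le> z v}" "card S < r"
  shows "(real r - real (card S)) * g \<le> (\<Sum>v\<in>e - S. min 1 (z v))"
proof -
  have "(\<Sum>v\<in>e - S. min 1 (z v)) = sum z (e - S)"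
    using S_eq by (intro sum.cong) auto
  then show ?thesis using cover S_eq by (auto simp: knapsack_cover_def)
qed

lemma knapsack_cover_sum_min_ge:
  assumes cover: "knapsack_cover z e r g" and finite_e: "finite e"
    and z_nonneg: "\<And>v. v \<in> e \<Longrightarrow> 0 \<le> z v" and g_ge_1: "1 \<le> g"
  shows "real r \<le> (\<Sum>v\<in>e. min 1 (z v))"
proof -
  define S where "S = {v \<in> e. 1 \<le> z v}"
  have "(\<Sum>v\<in>e. min 1 (z v)) = (\<Sum>v\<in>e - S. min 1 (z v)) + (\<Sum>v\<in>S. min 1 (z v))"
    using finite_e by (intro sum.subset_diff) (auto simp: S_def)
  then have sum_split: "(\<Sum>v\<in>e. min 1 (z v)) = (\<Sum>v\<in>e - S. min 1 (z v)) + real (card S)"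
    by (simp add: S_def)
  show ?thesis
  proof (cases "card S < r")
    case True
    then have "(real r - real (card S)) * 1 \<le> (real r - real (card S)) * g"
      using g_ge_1 by (intro mult_left_mono) auto
    also have "\<dots> \<le> (\<Sum>v\<in>e - S. min 1 (z v))"
      using cover S_def True by (rule knapsack_cover_residual)
    finally show ?thesis using sum_split by simp
  next
    case False
    have "0 \<le> (\<Sum>v\<in>e - S. min 1 (z v))" using z_nonneg by (intro sum_nonneg) auto
    then show ?thesis using sum_split False by simp
  qed
qed

lemma bernoulli_tail_Un_sure:
  assumes "finite S" "finite R" "S \<inter> R = {}" "\<And>i. i \<in> S \<Longrightarrow> p i = 1"
  shows "bernoulli_tail p (S \<union> R) k = bernoulli_tail p R (k - card S)"
  using assms(1,3,4)
proof (induction S arbitrary: k rule: finite_induct)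
  case empty
  then show ?case by simp
next
  case (insert i S)
  show ?case
  proof (cases k)
    case 0
    then show ?thesis by (simp add: poisson_bernoulli_tail_def)
  next
    case (Suc m)
    then show ?thesis
      using insert assms(2) by (simp add: bernoulli_tail_insert)
  qed
qed

theorem knapsack_cover_bernoulli_tail_le:
  assumes tail: "tail_bound_function P" and anti: "antimono_on {1..} P"
    and cover: "knapsack_cover z e r g" and finite_e: "finite e"
    and z_nonneg: "\<And>v. v \<in> e \<Longrightarrow> 0 \<le> z v" and g_ge_1: "1 \<le> g"
  shows "bernoulli_tail (\<lambda>v. min 1 (z v)) e r \<le> P g"
proof -
  define S where "S = {v \<in> e. 1 \<le> z v}"
  let ?p = "\<lambda>v. min 1 (z v)"
  have "bernoulli_tail ?p (S \<union> (e - S)) r = bernoulli_tail ?p (e - S) (r - card S)"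
    using finite_e by (intro bernoulli_tail_Un_sure) (auto simp: S_def)
  moreover have "S \<union> (e - S) = e" by (auto simp: S_def)
  ultimately have residual: "bernoulli_tail ?p e r = bernoulli_tail ?p (e - S) (r - card S)" by simp
  show ?thesis
  proof (cases "card S < r")
    case True
    define \<gamma> where "\<gamma> = (\<Sum>v\<in>e - S. ?p v) / real (r - card S)"
    have "(real r - real (card S)) * g \<le> (\<Sum>v\<in>e - S. ?p v)"
      using cover S_def True by (rule knapsack_cover_residual)
    then have \<gamma>_ge: "g \<le> \<gamma>" using True by (simp add: \<gamma>_def field_simps)
    have "sum ?p (e - S) = \<gamma> * real (r - card S)" using True by (simp add: \<gamma>_def)
    then have "bernoulli_tail ?p (e - S) (r - card S) \<le> P \<gamma>"
      using finite_e z_nonneg True \<gamma>_ge g_ge_1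
      by (intro tail_bound_function_bernoulli_tail_le[OF tail]) auto
    also have "\<dots> \<le> P g"
      using \<gamma>_ge g_ge_1 by (intro monotone_onD[OF anti]) auto
    finally show ?thesis by (simp add: residual)
  next
    case False
    then show ?thesis
      unfolding residual using tail_bound_function_nonneg[OF tail g_ge_1]
      by (simp add: poisson_bernoulli_tail_def)
  qed
qed

section \<open>The linear program\<close>

lemma lp_feasible_iff:
  "lp_feasible V E k x u \<longleftrightarrow>
     (\<forall>v\<in>V. \<forall>t\<in>{1..card V}. 0 \<le> x v t) \<and> (\<forall>e\<in>E. \<forall>t\<in>{1..card V}. 0 \<le> u e t) \<and>
     (\<forall>t\<in>{1..card V}. (\<Sum>v\<in>V. x v t) \<le> 1) \<and>
     (\<forall>e\<in>E. \<forall>t\<in>{1..card V}. knapsack_cover (\<lambda>v. \<Sum>t'\<in>{1..<t}. x v t') e (k e) (1 - u e t))"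
  by (simp add: lp_feasible_def knapsack_cover_def imp_conjL algebra_simps)

lemma gmssc_instance_edge:
  assumes "gmssc_instance V E k" "e \<in> E"
  shows "e \<subseteq> V" "finite e" "1 \<le> k e" "k e \<le> card e"
  using assms finite_subset by (auto simp: gmssc_instance_def)

lemma ordering_lp_feasible:
  assumes inst: "gmssc_instance V E k" and \<sigma>_ordering: "\<sigma> \<in> orderings V"
  shows "lp_feasible V E k (\<lambda>v t. of_bool (\<sigma> v = t)) (\<lambda>e t. of_bool (t \<le> cover_time k \<sigma> e))"
  unfolding lp_feasible_iff
proof (intro conjI ballI)
  fix t
  have finite_V: "finite V" using inst by (simp add: gmssc_instance_def)
  have "card {v \<in> V. \<sigma> v = t} \<le> 1"
    using finite_V inj_onD[OF bij_betw_imp_inj_on[OF orderings_bij_betw[OF \<sigma>_ordering]]]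
      card_le_Suc0_iff_eq[of "{v \<in> V. \<sigma> v = t}"] by simp
  then show "(\<Sum>v\<in>V. of_bool (\<sigma> v = t)) \<le> (1 :: real)"
    using finite_V by (simp add: Int_def)
next
  fix e t assume "e \<in> E"
  note e_props = gmssc_instance_edge[OF inst this]
  have prefix: "(\<Sum>t'\<in>{1..<t}. of_bool (\<sigma> v = t')) = (of_bool (\<sigma> v < t) :: real)" if "v \<in> e" for v
    using orderings_range[OF \<sigma>_ordering, of v] that e_props(1) by (auto simp: of_bool_def)
  have "knapsack_cover (\<lambda>v. of_bool (\<sigma> v < t)) e (k e) (1 - of_bool (t \<le> cover_time k \<sigma> e))"
  proof (cases "t \<le> cover_time k \<sigma> e")
    case True
    then show ?thesis by (simp add: knapsack_cover_0)
  next
    case False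
    have "k e \<le> card {v \<in> e. \<sigma> v \<le> cover_time k \<sigma> e}"
      using \<sigma>_ordering e_props by (intro card_cover_time_ge)
    also have "\<dots> \<le> card {v \<in> e. \<sigma> v < t}"
      using False e_props by (intro card_mono) auto
    finally show ?thesis using False e_props by (simp add: knapsack_cover_of_bool)
  qed
  then show "knapsack_cover (\<lambda>v. \<Sum>t'\<in>{1..<t}. of_bool (\<sigma> v = t')) e (k e)
      (1 - of_bool (t \<le> cover_time k \<sigma> e))"
    by (simp only: prefix cong: knapsack_cover_cong)
qed auto

theorem lp_optimal_le_gmssc_opt:
  assumes inst: "gmssc_instance V E k" and opt: "lp_optimal V E k x u"
  shows "lp_value V E u \<le> real (gmssc_opt V E k)"
proof -
  have finite_V: "finite V" using inst by (simp add: gmssc_instance_def)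
  have "orderings V \<noteq> {}"
    using sorted_orderings_nonempty[OF finite_V, of "\<lambda>_. 0"] by (auto simp: sorted_orderings_def)
  then have "gmssc_opt V E k \<in> gmssc_cost E k ` orderings V"
    unfolding gmssc_opt_def using finite_orderings[OF finite_V] by (intro Min_in) auto
  then obtain \<sigma> where \<sigma>_optimal: "\<sigma> \<in> orderings V" "gmssc_opt V E k = gmssc_cost E k \<sigma>" by blast
  have "lp_value V E u \<le> lp_value V E (\<lambda>e t. of_bool (t \<le> cover_time k \<sigma> e))"
    using opt ordering_lp_feasible[OF inst \<sigma>_optimal(1)] unfolding lp_optimal_def by blast
  also have "\<dots> = (\<Sum>e\<in>E. real (cover_time k \<sigma> e))"
    unfolding lp_value_def
  proof (intro sum.cong refl)
    fix e assume "e \<in> E"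
    then have "cover_time k \<sigma> e \<le> card V"
      using gmssc_instance_edge[OF inst] by (intro cover_time_le_card[OF \<sigma>_optimal(1)])
    then have "{1..card V} \<inter> {t. t \<le> cover_time k \<sigma> e} = {1..cover_time k \<sigma> e}" by auto
    then show "(\<Sum>t\<in>{1..card V}. of_bool (t \<le> cover_time k \<sigma> e)) = real (cover_time k \<sigma> e)"
      by simp
  qed
  finally show ?thesis using \<sigma>_optimal by (simp add: gmssc_cost_def)
qed

section \<open>The integral bound\<close>

lemma sum_antimono_le_nn_integral:
  fixes F :: "real \<Rightarrow> ennreal"
  assumes [measurable]: "F \<in> borel_measurable borel"
    and anti: "antimono_on {0<..} F"
  shows "(\<Sum>t<n. F (real (Suc t))) \<le> (\<integral>\<^sup>+x\<in>{0<..real n}. F x \<partial>lborel)"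
proof (induction n)
  case 0
  then show ?case by simp
next
  case (Suc n)
  have "F (real (Suc n)) = (\<integral>\<^sup>+x. F (real (Suc n)) * indicator {real n<..real (Suc n)} x \<partial>lborel)"
    by (subst nn_integral_cmult_indicator) auto
  also have "\<dots> \<le> (\<integral>\<^sup>+x\<in>{real n<..real (Suc n)}. F x \<partial>lborel)"
    using monotone_onD[OF anti]
    by (intro nn_integral_mono) (auto simp: indicator_def simp del: of_nat_Suc)
  finally have "(\<Sum>t<Suc n. F (real (Suc t)))
      \<le> (\<integral>\<^sup>+x\<in>{0<..real n}. F x \<partial>lborel) + (\<integral>\<^sup>+x\<in>{real n<..real (Suc n)}. F x \<partial>lborel)"
    using Suc by (simp add: add_mono)
  also have "\<dots> = (\<integral>\<^sup>+x\<in>{0<..real n} \<union> {real n<..real (Suc n)}. F x \<partial>lborel)"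
    by (rule nn_integral_disjoint_pair[symmetric]) auto
  also have "{0<..real n} \<union> {real n<..real (Suc n)} = {0<..real (Suc n)}" by auto
  finally show ?case .
qed

lemma nn_integral_exp_substitution:
  fixes f :: "real \<Rightarrow> real"
  assumes [measurable]: "f \<in> borel_measurable borel" and \<beta>_pos: "0 < \<beta>" and U_pos: "0 < U"
    and a_le_b: "a \<le> b"
  shows "(\<integral>\<^sup>+x\<in>{U * exp (a / \<beta>)..U * exp (b / \<beta>)}. ennreal (f (\<beta> * ln (x / U))) \<partial>lborel)
    = (\<integral>\<^sup>+y\<in>{a..b}. ennreal (U / \<beta> * exp (y / \<beta>) * f y) \<partial>lborel)"
proof -
  let ?g = "\<lambda>y. U * exp (y / \<beta>)"
  have "(\<integral>\<^sup>+x\<in>{?g a..?g b}. ennreal (f (\<beta> * ln (x / U))) \<partial>lborel)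
      = (\<integral>\<^sup>+x. ennreal (f (\<beta> * ln (x / U)) * indicator {?g a..?g b} x) \<partial>lborel)"
    by (intro nn_integral_cong) (auto simp: indicator_def)
  also have "\<dots>
      = (\<integral>\<^sup>+y. ennreal (f (\<beta> * ln (?g y / U)) * (U / \<beta> * exp (y / \<beta>)) * indicator {a..b} y) \<partial>lborel)"
  proof (rule nn_integral_substitution[OF _ _ _ _ a_le_b])
    show "set_borel_measurable borel {?g a..?g b} (\<lambda>x. f (\<beta> * ln (x / U)))"
      unfolding set_borel_measurable_def by measurable
    show "(?g has_real_derivative U / \<beta> * exp (y / \<beta>)) (at y)" for y
      using \<beta>_pos by (auto intro!: derivative_eq_intros)
    show "continuous_on {a..b} (\<lambda>y. U / \<beta> * exp (y / \<beta>))"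
      using \<beta>_pos by (intro continuous_intros) auto
  qed (use U_pos \<beta>_pos in auto)
  also have "\<dots> = (\<integral>\<^sup>+y\<in>{a..b}. ennreal (U / \<beta> * exp (y / \<beta>) * f y) \<partial>lborel)"
    using U_pos \<beta>_pos by (intro nn_integral_cong) (auto simp: indicator_def mult.commute)
  finally show ?thesis .
qed

lemma nn_integral_log_le_kernel_r:
  assumes [measurable]: "Q \<in> borel_measurable borel" and \<beta>_pos: "0 < \<beta>" and U_pos: "0 < U"
    and b_ge_1: "1 \<le> b"
  shows "ennreal (U * exp (1 / \<beta>))
      + (\<integral>\<^sup>+x\<in>{U * exp (1 / \<beta>)..U * exp (b / \<beta>)}. ennreal (Q (\<beta> * ln (x / U))) \<partial>lborel)
    \<le> ennreal U * kernel_r Q \<beta>"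
proof -
  define c where "c = U * exp (1 / \<beta>)"
  have "(\<integral>\<^sup>+x\<in>{c..U * exp (b / \<beta>)}. ennreal (Q (\<beta> * ln (x / U))) \<partial>lborel)
      = (\<integral>\<^sup>+y\<in>{1..b}. ennreal (U / \<beta> * exp (y / \<beta>) * Q y) \<partial>lborel)"
    unfolding c_def using \<beta>_pos U_pos b_ge_1 by (intro nn_integral_exp_substitution) auto
  also have "\<dots>
      \<le> (\<integral>\<^sup>+y. ennreal (c / \<beta>) * (ennreal (Q y * exp ((y - 1) / \<beta>)) * indicator {1..} y) \<partial>lborel)"
  proof (rule nn_integral_mono)
    fix y :: real
    have "U / \<beta> * exp (y / \<beta>) * Q y = c / \<beta> * (Q y * exp ((y - 1) / \<beta>))"
      by (simp add: c_def diff_divide_distrib exp_diff)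
    then have ennreal_eq: "ennreal (U / \<beta> * exp (y / \<beta>) * Q y)
        = ennreal (c / \<beta>) * ennreal (Q y * exp ((y - 1) / \<beta>))"
      using \<beta>_pos U_pos by (simp only: c_def) (rule ennreal_mult', simp)
    show "ennreal (U / \<beta> * exp (y / \<beta>) * Q y) * indicator {1..b} y
        \<le> ennreal (c / \<beta>) * (ennreal (Q y * exp ((y - 1) / \<beta>)) * indicator {1..} y)"
      unfolding ennreal_eq by (simp add: indicator_def)
  qed
  also have "\<dots> = ennreal (c / \<beta>) * (\<integral>\<^sup>+y\<in>{1..}. ennreal (Q y * exp ((y - 1) / \<beta>)) \<partial>lborel)"
    by (rule nn_integral_cmult) measurable
  finally have "ennreal c + (\<integral>\<^sup>+x\<in>{c..U * exp (b / \<beta>)}. ennreal (Q (\<beta> * ln (x / U))) \<partial>lborel)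
      \<le> ennreal c + ennreal (c / \<beta>) * (\<integral>\<^sup>+y\<in>{1..}. ennreal (Q y * exp ((y - 1) / \<beta>)) \<partial>lborel)"
    by (rule add_left_mono)
  moreover have "ennreal c = ennreal U * ennreal (exp (1 / \<beta>))"
    "ennreal (c / \<beta>) = ennreal U * ennreal (exp (1 / \<beta>)) * ennreal (1 / \<beta>)"
    using U_pos \<beta>_pos by (simp_all add: c_def flip: ennreal_mult')
  ultimately show ?thesis by (simp add: c_def kernel_r_def distrib_left mult.assoc)
qed

lemma borel_measurable_antimono:
  fixes f :: "real \<Rightarrow> real"
  assumes "antimono f"
  shows "f \<in> borel_measurable borel"
proof -
  have "(\<lambda>x. - f x) \<in> borel_measurable borel"
    using assms by (intro borel_measurable_mono) (auto simp: monotone_def)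
  then show ?thesis by simp
qed

lemma le_mult_exp_divide:
  fixes x :: real
  assumes "0 < x" "0 < \<beta>" "0 < U" "\<beta> * ln (x / U) \<le> b"
  shows "x \<le> U * exp (b / \<beta>)"
proof -
  have "ln (x / U) \<le> b / \<beta>"
    using assms by (simp add: pos_le_divide_eq mult.commute)
  then have "exp (ln (x / U)) \<le> exp (b / \<beta>)" by simp
  then show ?thesis
    using assms by (simp add: pos_divide_le_eq mult.commute)
qed

theorem sum_antimono_le_kernel_r:
  fixes Q :: "real \<Rightarrow> real"
  assumes anti: "antimono Q" and Q_le_1: "\<And>y. Q y \<le> 1" and \<beta>_pos: "0 < \<beta>" and U_pos: "0 < U"
  shows "(\<Sum>t<n. ennreal (Q (\<beta> * ln (real (Suc t) / U)))) \<le> ennreal U * kernel_r Q \<beta>"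
proof -
  define c where "c = U * exp (1 / \<beta>)"
  define b where "b = max 1 (\<beta> * ln (real n / U))"
  have [measurable]: "Q \<in> borel_measurable borel"
    using anti by (rule borel_measurable_antimono)
  have "antimono_on {0<..} (\<lambda>x. ennreal (Q (\<beta> * ln (x / U))))"
    using \<beta>_pos U_pos by (intro monotone_onI ennreal_leI antimonoD[OF anti] mult_left_mono)
      (auto simp: divide_right_mono)
  then have "(\<Sum>t<n. ennreal (Q (\<beta> * ln (real (Suc t) / U))))
      \<le> (\<integral>\<^sup>+x\<in>{0<..real n}. ennreal (Q (\<beta> * ln (x / U))) \<partial>lborel)"
    by (intro sum_antimono_le_nn_integral) measurable
  also have "\<dots> \<le> (\<integral>\<^sup>+x. indicator {0..c} x
      + ennreal (Q (\<beta> * ln (x / U))) * indicator {c..U * exp (b / \<beta>)} x \<partial>lborel)"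
  proof (rule nn_integral_mono)
    fix x :: real
    have "x \<le> U * exp (b / \<beta>)" if "0 < x" "x \<le> real n"
    proof -
      have "\<beta> * ln (real n / U) \<le> b" by (simp add: b_def)
      then have "real n \<le> U * exp (b / \<beta>)"
        using that \<beta>_pos U_pos by (intro le_mult_exp_divide) auto
      with that show ?thesis by simp
    qed
    moreover have "ennreal (Q (\<beta> * ln (x / U))) \<le> 1"
      using Q_le_1 by simp
    ultimately show "ennreal (Q (\<beta> * ln (x / U))) * indicator {0<..real n} x
        \<le> indicator {0..c} x + ennreal (Q (\<beta> * ln (x / U))) * indicator {c..U * exp (b / \<beta>)} x"
      by (cases "x \<le> c") (simp_all add: indicator_def add_increasing2)
  qed
  also have "\<dots> = ennreal c + (\<integral>\<^sup>+x\<in>{c..U * exp (b / \<beta>)}. ennreal (Q (\<beta> * ln (x / U))) \<partial>lborel)"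
    using U_pos by (subst nn_integral_add) (auto simp: c_def)
  also have "\<dots> \<le> ennreal U * kernel_r Q \<beta>"
    unfolding c_def using \<beta>_pos U_pos by (intro nn_integral_log_le_kernel_r) (auto simp: b_def)
  finally show ?thesis .
qed

lemma kernel_r_mono:
  assumes "\<And>x. 1 \<le> x \<Longrightarrow> P x \<le> Q x"
  shows "kernel_r P \<beta> \<le> kernel_r Q \<beta>"
  unfolding kernel_r_def using assms
  by (intro mult_left_mono add_left_mono nn_integral_mono)
    (auto simp: indicator_def intro!: ennreal_leI mult_right_mono)

lemma kernel_r_cong: "(\<And>x. 1 \<le> x \<Longrightarrow> P x = Q x) \<Longrightarrow> kernel_r P \<beta> = kernel_r Q \<beta>"
  by (intro antisym kernel_r_mono) simp_all

text \<open>Below rate \<open>1\<close> a tail bound function says nothing, and probabilities are bounded by \<open>1\<close>.\<close>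

definition tail_extension :: "(real \<Rightarrow> real) \<Rightarrow> real \<Rightarrow> real" where
  "tail_extension P y = (if y < 1 then 1 else P y)"

lemma tail_extension_le_1:
  assumes "antimono_on {1..} P" "P 1 \<le> 1"
  shows "tail_extension P y \<le> 1"
  using monotone_onD[OF assms(1), of 1 y] assms(2) by (auto simp: tail_extension_def)

lemma antimono_tail_extension:
  assumes "antimono_on {1..} P" "P 1 \<le> 1"
  shows "antimono (tail_extension P)"
proof (rule antimonoI)
  fix x y :: real assume "x \<le> y"
  then show "tail_extension P y \<le> tail_extension P x"
    using monotone_onD[OF assms(1), of x y] tail_extension_le_1[OF assms, of y]
    by (auto simp: tail_extension_def)
qed

corollary sum_tail_extension_le_kernel_r:
  assumes "antimono_on {1..} P" "P 1 \<le> 1" "0 < \<beta>" "0 < U"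
  shows "(\<Sum>t<n. ennreal (tail_extension P (\<beta> * ln (real (Suc t) / U)))) \<le> ennreal U * kernel_r P \<beta>"
proof -
  have "kernel_r (tail_extension P) \<beta> = kernel_r P \<beta>"
    by (rule kernel_r_cong) (simp add: tail_extension_def)
  then show ?thesis
    using sum_antimono_le_kernel_r[OF antimono_tail_extension tail_extension_le_1] assms by metis
qed

section \<open>Independent uniform thresholds\<close>

lemma indep_vars_PiM_coordinates:
  assumes prob_space_M: "\<And>i. i \<in> I \<Longrightarrow> prob_space (M i)" and J_subset: "J \<subseteq> I"
  shows "prob_space.indep_vars (PiM I M) M (\<lambda>i \<omega>. \<omega> i) J"
proof -
  interpret prob_space "PiM I M" using prob_space_M by (rule prob_space_PiM)
  show ?thesis
  proof (cases "J = {}")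
    case True
    then show ?thesis by (simp add: indep_vars_def indep_sets_def)
  next
    case False
    then have "I \<noteq> {}" using J_subset by blast
    have "distr (PiM I M) (PiM I M) (\<lambda>\<omega>. \<lambda>i\<in>I. \<omega> i) = distr (PiM I M) (PiM I M) (\<lambda>\<omega>. \<omega>)"
      by (intro distr_cong) (auto simp: space_PiM PiE_restrict)
    also have "\<dots> = PiM I (\<lambda>i. distr (PiM I M) (M i) (\<lambda>\<omega>. \<omega> i))"
      using prob_space_M by (auto intro!: PiM_cong simp: distr_PiM_component)
    finally have "indep_vars M (\<lambda>i \<omega>. \<omega> i) I"
      using \<open>I \<noteq> {}\<close> by (subst indep_vars_iff_distr_eq_PiM') auto
    then show ?thesis using J_subset by (rule indep_vars_subset)
  qed
qed



lemma (in product_prob_space) nn_integral_PiM_independent_time: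
  fixes T :: "('i \<Rightarrow> 'a) \<Rightarrow> nat"
  assumes finite_I: "finite I" and J_subset: "J \<subseteq> I"
    and [measurable]: "T \<in> measurable (PiM I M) (count_space UNIV)"
    and [measurable]: "\<And>t. f t \<in> borel_measurable (PiM I M)"
    and T_dep: "\<And>\<omega>. T \<omega> = T (restrict \<omega> J)" and f_dep: "\<And>t \<omega>. f t \<omega> = f t (restrict \<omega> (I - J))"
  shows "(\<integral>\<^sup>+\<omega>. f (T \<omega>) \<omega> \<partial>PiM I M) = (\<integral>\<^sup>+\<omega>. (\<integral>\<^sup>+\<omega>'. f (T \<omega>) \<omega>' \<partial>PiM I M) \<partial>PiM I M)"
proof -
  interpret J: prob_space "PiM J M" by (intro prob_space_PiM) unfold_locales
  interpret IJ: prob_space "PiM (I - J) M" by (intro prob_space_PiM) unfold_locales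
  have integral_merge: "(\<integral>\<^sup>+\<omega>. g \<omega> \<partial>PiM I M)
      = (\<integral>\<^sup>+\<omega>. (\<integral>\<^sup>+\<omega>'. g (merge J (I - J) (\<omega>, \<omega>')) \<partial>PiM (I - J) M) \<partial>PiM J M)"
    if "g \<in> borel_measurable (PiM I M)" for g
  proof -
    have "J \<union> (I - J) = I" using J_subset by auto
    then show ?thesis
      using product_nn_integral_fold[of J "I - J" g] that finite_I J_subset finite_subset by auto
  qed
  have T_merge: "T (merge J (I - J) (\<omega>, \<omega>')) = T \<omega>" for \<omega> \<omega>'
    using T_dep[of "merge J (I - J) (\<omega>, \<omega>')"] T_dep[of \<omega>] by (simp add: restrict_merge)
  have f_merge: "f t (merge J (I - J) (\<omega>, \<omega>')) = f t \<omega>'" for t \<omega> \<omega>'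
    using f_dep[of t "merge J (I - J) (\<omega>, \<omega>')"] f_dep[of t \<omega>'] by (simp add: restrict_merge)
  have integral_T: "(\<integral>\<^sup>+\<omega>. g (T \<omega>) \<partial>PiM I M) = (\<integral>\<^sup>+\<omega>. g (T \<omega>) \<partial>PiM J M)" for g :: "nat \<Rightarrow> ennreal"
    by (subst integral_merge) (measurable, simp add: T_merge IJ.emeasure_space_1)
  have "(\<integral>\<^sup>+\<omega>. f t \<omega> \<partial>PiM I M) = (\<integral>\<^sup>+\<omega>'. f t \<omega>' \<partial>PiM (I - J) M)" for t
    by (simp add: integral_merge f_merge J.emeasure_space_1)
  then have "(\<integral>\<^sup>+\<omega>. (\<integral>\<^sup>+\<omega>'. f (T \<omega>) \<omega>' \<partial>PiM I M) \<partial>PiM I M)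
      = (\<integral>\<^sup>+\<omega>. (\<integral>\<^sup>+\<omega>'. f (T \<omega>) \<omega>' \<partial>PiM (I - J) M) \<partial>PiM I M)"
    by simp
  also have "\<dots> = (\<integral>\<^sup>+\<omega>. (\<integral>\<^sup>+\<omega>'. f (T \<omega>) \<omega>' \<partial>PiM (I - J) M) \<partial>PiM J M)"
    by (rule integral_T)
  also have "\<dots> = (\<integral>\<^sup>+\<omega>. f (T \<omega>) \<omega> \<partial>PiM I M)"
    by (subst integral_merge) (measurable, simp add: T_merge f_merge)
  finally show ?thesis by (rule sym)
qed

abbreviation uniform_thresholds :: "'v set \<Rightarrow> ('v \<Rightarrow> real) measure" where
  "uniform_thresholds V \<equiv> PiM V (\<lambda>_. uniform_measure lborel {0..1})"

lemma prob_space_uniform_unit: "prob_space (uniform_measure lborel {0..1 :: real})"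
  by (rule prob_space_uniform_measure) auto

lemma prob_space_uniform_thresholds: "prob_space (uniform_thresholds V)"
  by (intro prob_space_PiM prob_space_uniform_unit)

lemma emeasure_uniform_unit_atMost:
  assumes "0 \<le> z"
  shows "emeasure (uniform_measure lborel {0..1}) {..z} = ennreal (min 1 z)"
proof -
  have "{0..1} \<inter> {..z} = {0..min 1 z}" by auto
  then show ?thesis using assms by (simp add: divide_ennreal_def)
qed

lemma emeasure_threshold_le:
  assumes "v \<in> V" "0 \<le> z"
  shows "emeasure (uniform_thresholds V) {\<alpha> \<in> space (uniform_thresholds V). \<alpha> v \<le> z}
    = ennreal (min 1 z)"
proof -
  interpret product_prob_space "\<lambda>_. uniform_measure lborel {0..1 :: real}" V
    by (intro product_prob_spaceI prob_space_uniform_unit)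
  show ?thesis
    using assms emeasure_PiM_Collect_single[of v "{..z}"]
    by (simp add: emeasure_uniform_unit_atMost divide_ennreal_def)
qed

lemma measurable_card_thresholds_le [measurable]:
  assumes "finite I" "I \<subseteq> V"
  shows "(\<lambda>\<alpha>. card {v \<in> I. \<alpha> v \<le> z v}) \<in> measurable (uniform_thresholds V) (count_space UNIV)"
proof -
  have "(\<lambda>\<alpha>. \<Sum>v\<in>I. of_bool (\<alpha> v \<le> z v) :: nat) \<in> measurable (uniform_thresholds V) (count_space UNIV)"
    using assms by (intro measurable_sum_nat) (measurable, auto)
  then show ?thesis using assms by (simp add: Int_def)
qed

lemma nn_integral_card_thresholds_le:
  assumes I_finite_subset: "finite I" "I \<subseteq> V" and z_nonneg: "\<And>v. v \<in> I \<Longrightarrow> 0 \<le> z v"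
  shows "(\<integral>\<^sup>+\<alpha>. of_nat (card {v \<in> I. \<alpha> v \<le> z v}) \<partial>uniform_thresholds V) = ennreal (\<Sum>v\<in>I. min 1 (z v))"
proof -
  let ?A = "\<lambda>v. {\<alpha> \<in> space (uniform_thresholds V). \<alpha> v \<le> z v}"
  have sets_A: "?A v \<in> sets (uniform_thresholds V)" if "v \<in> I" for v
    using that I_finite_subset by (intro sets_Collect_single') auto
  have "(\<integral>\<^sup>+\<alpha>. of_nat (card {v \<in> I. \<alpha> v \<le> z v}) \<partial>uniform_thresholds V)
      = (\<integral>\<^sup>+\<alpha>. (\<Sum>v\<in>I. indicator (?A v) \<alpha>) \<partial>uniform_thresholds V)"
    using I_finite_subset
    by (intro nn_integral_cong) (simp add: indicator_def Int_def flip: of_bool_def)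
  also have "\<dots> = (\<Sum>v\<in>I. emeasure (uniform_thresholds V) (?A v))"
    using sets_A by (subst nn_integral_sum) auto
  also have "\<dots> = (\<Sum>v\<in>I. ennreal (min 1 (z v)))"
    using I_finite_subset z_nonneg by (intro sum.cong refl emeasure_threshold_le) auto
  also have "\<dots> = ennreal (\<Sum>v\<in>I. min 1 (z v))"
    using z_nonneg by (intro sum_ennreal) auto
  finally show ?thesis .
qed

lemma emeasure_card_thresholds_le_less:
  assumes finite_V: "finite V" and I_subset: "I \<subseteq> V" and z_nonneg: "\<And>v. v \<in> I \<Longrightarrow> 0 \<le> z v"
  shows "emeasure (uniform_thresholds V) {\<alpha> \<in> space (uniform_thresholds V). card {v \<in> I. \<alpha> v \<le> z v} < r}
    = ennreal (bernoulli_tail (\<lambda>v. min 1 (z v)) I r)"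
proof -
  interpret prob_space "uniform_thresholds V"
    by (rule prob_space_uniform_thresholds)
  define Y :: "'a \<Rightarrow> ('a \<Rightarrow> real) \<Rightarrow> real" where "Y v \<alpha> = of_bool (\<alpha> v \<le> z v)" for v \<alpha>
  have finite_I: "finite I" using I_subset finite_V by (rule finite_subset)
  have "indep_vars (\<lambda>_. borel) (\<lambda>v \<alpha>. of_bool (\<alpha> v \<le> z v) :: real) I"
    by (rule indep_vars_compose2[OF indep_vars_PiM_coordinates[OF prob_space_uniform_unit I_subset]])
      measurable
  then have indep: "indep_vars (\<lambda>_. borel) Y I" by (simp add: Y_def[abs_def])
  have expectation_Y: "expectation (Y v) = min 1 (z v)" if "v \<in> I" for v
  proof -
    have "expectation (Y v) = expectation (indicator {\<alpha> \<in> space (uniform_thresholds V). \<alpha> v \<le> z v})"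
      by (intro Bochner_Integration.integral_cong refl) (simp add: Y_def indicator_def)
    also have "\<dots> = prob {\<alpha> \<in> space (uniform_thresholds V). \<alpha> v \<le> z v}"
      by (simp add: Int_absorb2 Collect_restrict)
    also have "\<dots> = min 1 (z v)"
      using emeasure_threshold_le[of v V "z v"] that I_subset z_nonneg[OF that]
      by (auto simp: measure_def)
    finally show ?thesis .
  qed
  have "bernoulli_tail (\<lambda>v. min 1 (z v)) I r = bernoulli_tail (\<lambda>v. expectation (Y v)) I r"
    by (simp add: expectation_Y poisson_bernoulli_tail_def poisson_bernoulli_gf_def)
  also have "\<dots> = prob {\<alpha> \<in> space (uniform_thresholds V). (\<Sum>v\<in>I. Y v \<alpha>) < real r}"
    using finite_I indep
    by (intro prob_indep_sum_less_eq_bernoulli_tail[symmetric]) (auto simp: Y_def)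
  also have "{\<alpha> \<in> space (uniform_thresholds V). (\<Sum>v\<in>I. Y v \<alpha>) < real r}
      = {\<alpha> \<in> space (uniform_thresholds V). card {v \<in> I. \<alpha> v \<le> z v} < r}"
    using finite_I by (simp add: Y_def Int_def)
  finally show ?thesis by (simp add: emeasure_eq_measure)
qed

section \<open>Kernel rounding\<close>

text \<open>Among all \<open>u\<close> with a given sum, the right-hand side is smallest when \<open>u\<close> is concentrated on the
  earliest times, where the weights \<open>1 / s\<close> are largest.\<close>

lemma ln_le_sum_deficit:
  fixes u :: "nat \<Rightarrow> real"
  assumes "\<And>s. s \<in> {1..t} \<Longrightarrow> u s \<in> {0..1}"
  shows "ln (real (Suc t) / (1 + (\<Sum>s=1..t. u s))) \<le> (\<Sum>s=1..t. (1 - u s) / real s)"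
  using assms
proof (induction t)
  case 0
  then show ?case by simp
next
  case (Suc t)
  define a where "a = real (Suc t)"
  define W where "W = 1 + (\<Sum>s=1..t. u s)"
  define q where "q = u (Suc t)"
  define y where "y = (a + 1) * W / (a * (W + q))"
  have q_unit: "0 \<le> q" "q \<le> 1" using Suc.prems[of "Suc t"] by (auto simp: q_def)
  have a_pos: "0 < a" by (simp add: a_def)
  have W_ge_1: "1 \<le> W" using Suc.prems by (auto simp: W_def intro!: sum_nonneg)
  have "(\<Sum>s=1..t. u s) \<le> (\<Sum>s=1..t. 1)" using Suc.prems by (intro sum_mono) auto
  then have "W \<le> a" by (simp add: W_def a_def)
  then have "0 \<le> q * (a + 1 - W - q)" using q_unit by simp
  then have "(a + 1) * W \<le> (a + 1 - q) * (W + q)" by (simp add: algebra_simps)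
  then have "(a + 1) * W / (W + q) \<le> a + 1 - q"
    using W_ge_1 q_unit by (simp add: pos_divide_le_eq)
  then have "y \<le> (a + 1 - q) / a"
    using a_pos divide_right_mono[of "(a + 1) * W / (W + q)" _ a] by (simp add: y_def mult.commute)
  then have "y - 1 \<le> (1 - q) / a"
    using a_pos by (simp add: field_simps)
  moreover have y_pos: "0 < y" using a_pos W_ge_1 q_unit by (simp add: y_def)
  ultimately have "ln y \<le> (1 - q) / a"
    using ln_le_minus_one[OF y_pos] by linarith
  moreover have "(a + 1) / (W + q) = a / W * y" "0 < a / W"
    using a_pos W_ge_1 q_unit by (simp_all add: y_def)
  then have "ln ((a + 1) / (W + q)) = ln (a / W) + ln y"
    using y_pos by (simp only: ln_mult_pos)
  ultimately show ?case
    using Suc by (simp add: a_def W_def q_def add_ac)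
qed

locale kernel_rounding =
  fixes V :: "'v set" and E k x u and \<beta> :: real
  assumes inst: "gmssc_instance V E k" and feasible: "lp_feasible V E k x u" and \<beta>_ge_1: "1 \<le> \<beta>"
begin

definition mass :: "'v \<Rightarrow> nat \<Rightarrow> real" where
  "mass v t = (\<Sum>s\<in>{1..t}. kernel_z V \<beta> x v s)"

definition edge_value :: "'v set \<Rightarrow> real" where
  "edge_value e = (\<Sum>t\<in>{1..card V}. u e t)"

definition rate :: "'v set \<Rightarrow> nat \<Rightarrow> real" where
  "rate e t = \<beta> * ln (real (Suc t) / edge_value e)"

lemma finite_V: "finite V"
  using inst by (simp add: gmssc_instance_def)

lemmas edge_props = gmssc_instance_edge[OF inst]

lemma kernel_z_nonneg: "v \<in> V \<Longrightarrow> 0 \<le> kernel_z V \<beta> x v t"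
  using feasible \<beta>_ge_1 unfolding kernel_z_def lp_feasible_def
  by (intro mult_nonneg_nonneg sum_nonneg) auto

lemma mass_nonneg: "v \<in> V \<Longrightarrow> 0 \<le> mass v t"
  by (simp add: mass_def kernel_z_nonneg sum_nonneg)

lemma mass_mono: "v \<in> V \<Longrightarrow> s \<le> t \<Longrightarrow> mass v s \<le> mass v t"
  unfolding mass_def by (intro sum_mono2 kernel_z_nonneg) auto

lemma sum_kernel_z_le:
  assumes "1 \<le> s"
  shows "(\<Sum>v\<in>V. kernel_z V \<beta> x v s) \<le> \<beta>"
proof -
  have "(\<Sum>v\<in>V. \<Sum>t\<in>{1..s}. if t \<le> card V then x v t else 0)
      = (\<Sum>t\<in>{1..s}. \<Sum>v\<in>V. if t \<le> card V then x v t else 0)"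
    by (rule sum.swap)
  also have "\<dots> \<le> (\<Sum>t\<in>{1..s}. 1)"
  proof (rule sum_mono)
    fix t assume "t \<in> {1..s}"
    then show "(\<Sum>v\<in>V. if t \<le> card V then x v t else 0) \<le> 1"
      using feasible by (cases "t \<le> card V") (auto simp: lp_feasible_def)
  qed
  finally have "\<beta> / real s * (\<Sum>v\<in>V. \<Sum>t\<in>{1..s}. if t \<le> card V then x v t else 0) \<le> \<beta> / real s * real s"
    using \<beta>_ge_1 by (intro mult_left_mono) auto
  then show ?thesis using assms by (simp add: kernel_z_def sum_distrib_left)
qed

lemma sum_mass_le: "(\<Sum>v\<in>V. mass v t) \<le> \<beta> * real t"
proof -
  have "(\<Sum>v\<in>V. mass v t) = (\<Sum>s\<in>{1..t}. \<Sum>v\<in>V. kernel_z V \<beta> x v s)"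
    unfolding mass_def by (rule sum.swap)
  also have "\<dots> \<le> (\<Sum>s\<in>{1..t}. \<beta>)"
    by (intro sum_mono sum_kernel_z_le) auto
  finally show ?thesis by (simp add: mult.commute)
qed

lemma alpha_point_le_iff:
  assumes v_in_V: "v \<in> V" and t_ge_1: "1 \<le> t"
  shows "alpha_point V \<beta> x \<alpha> v \<le> enat t \<longleftrightarrow> \<alpha> v \<le> mass v t"
proof
  assume "\<alpha> v \<le> mass v t"
  then show "alpha_point V \<beta> x \<alpha> v \<le> enat t"
    using t_ge_1 unfolding alpha_point_def mass_def by (intro Inf_lower) auto
next
  define A where "A = enat ` {t. 1 \<le> t \<and> \<alpha> v \<le> mass v t}"
  assume "alpha_point V \<beta> x \<alpha> v \<le> enat t"
  then have Inf_le: "Inf A \<le> enat t" by (simp add: alpha_point_def A_def mass_def)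
  then have "A \<noteq> {}" by (auto simp: top_enat_def)
  then have "Inf A \<in> A"
    unfolding Inf_enat_def by (auto intro: LeastI)
  then obtain s where "\<alpha> v \<le> mass v s" "Inf A = enat s"
    unfolding A_def by auto
  then show "\<alpha> v \<le> mass v t"
    using Inf_le mass_mono[OF v_in_V, of s t] by simp
qed

lemma card_V_ge_1: "e \<in> E \<Longrightarrow> 1 \<le> card V"
  using edge_props[of e] card_mono[OF finite_V, of e] by linarith

lemma edge_u_1_ge_1:
  assumes e_in_E: "e \<in> E"
  shows "1 \<le> u e 1"
proof -
  have "knapsack_cover (\<lambda>v. \<Sum>t'\<in>{1..<1}. x v t') e (k e) (1 - u e 1)"
    using feasible e_in_E card_V_ge_1[OF e_in_E] unfolding lp_feasible_iff
    by (metis atLeastAtMost_iff order_refl)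
  then have "real (k e) * (1 - u e 1) \<le> 0"
    using edge_props[OF e_in_E] by (auto simp: knapsack_cover_def dest!: spec[of _ "{}"])
  then show ?thesis using edge_props[OF e_in_E] by (simp add: mult_le_0_iff)
qed

lemma edge_value_ge:
  assumes e_in_E: "e \<in> E" and t_less: "t < card V"
  shows "1 + (\<Sum>s=1..t. min 1 (u e (Suc s))) \<le> edge_value e"
proof -
  have "1 + (\<Sum>s=1..t. min 1 (u e (Suc s))) \<le> u e 1 + (\<Sum>s=1..t. u e (Suc s))"
    using edge_u_1_ge_1[OF e_in_E] by (intro add_mono sum_mono) auto
  also have "\<dots> = (\<Sum>s=1..Suc t. u e s)"
    by (subst sum.atLeast_Suc_atMost[of 1 "Suc t"]) (simp, simp only: sum.shift_bounds_cl_Suc_ivl)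
  also have "\<dots> \<le> edge_value e"
    unfolding edge_value_def using t_less e_in_E feasible
    by (intro sum_mono2) (auto simp: lp_feasible_def)
  finally show ?thesis .
qed

lemma edge_value_ge_1: "e \<in> E \<Longrightarrow> 1 \<le> edge_value e"
  using edge_value_ge[of e 0] card_V_ge_1[of e] by simp

lemma rate_le_sum_deficit:
  assumes e_in_E: "e \<in> E" and t_less: "t < card V"
  shows "rate e t \<le> (\<Sum>s=1..t. \<beta> / real s * (1 - min 1 (u e (Suc s))))"
proof -
  define W where "W = 1 + (\<Sum>s=1..t. min 1 (u e (Suc s)))"
  have u_unit: "min 1 (u e (Suc s)) \<in> {0..1}" if "s \<in> {1..t}" for s
    using feasible e_in_E t_less that by (auto simp: lp_feasible_def)
  then have W_ge_1: "1 \<le> W" by (auto simp: W_def intro!: sum_nonneg)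
  have "ln (real (Suc t) / edge_value e) \<le> ln (real (Suc t) / W)"
    using W_ge_1 edge_value_ge[OF e_in_E t_less] by (simp add: W_def frac_le)
  also have "\<dots> \<le> (\<Sum>s=1..t. (1 - min 1 (u e (Suc s))) / real s)"
    unfolding W_def using u_unit by (rule ln_le_sum_deficit)
  finally have "rate e t \<le> \<beta> * (\<Sum>s=1..t. (1 - min 1 (u e (Suc s))) / real s)"
    unfolding rate_def using \<beta>_ge_1 by (intro mult_left_mono) auto
  then show ?thesis by (simp add: sum_distrib_left)
qed



theorem knapsack_cover_mass:
  assumes e_in_E: "e \<in> E" and t_less: "t < card V"
  shows "knapsack_cover (\<lambda>v. mass v t) e (k e) (rate e t)"
proof -
  let ?prefix = "\<lambda>s v. \<Sum>t'\<in>{1..<Suc s}. x v t'"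
  have "knapsack_cover (?prefix s) e (k e) (1 - min 1 (u e (Suc s)))" if "s \<in> {1..t}" for s
  proof (cases "u e (Suc s) \<le> 1")
    case True
    have "Suc s \<in> {1..card V}" using that t_less by auto
    then show ?thesis
      using feasible e_in_E True unfolding lp_feasible_iff by (simp del: sum.op_ivl_Suc)
  next
    case False
    have "0 \<le> ?prefix s v" if "v \<in> e" for v
      using feasible edge_props[OF e_in_E] that \<open>s \<in> {1..t}\<close> t_less
      by (intro sum_nonneg) (auto simp: lp_feasible_def)
    then show ?thesis
      using False by (simp add: knapsack_cover_0 del: sum.op_ivl_Suc)
  qed
  then have "knapsack_cover (\<lambda>v. \<Sum>s=1..t. \<beta> / real s * ?prefix s v) e (k e)
      (\<Sum>s=1..t. \<beta> / real s * (1 - min 1 (u e (Suc s))))"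
    using \<beta>_ge_1 by (intro knapsack_cover_sum) auto
  moreover have "(\<Sum>s=1..t. \<beta> / real s * ?prefix s v) = mass v t" for v
    unfolding mass_def kernel_z_def using t_less
    by (intro sum.cong refl arg_cong2[where f = "(*)"]) auto
  ultimately show ?thesis
    using rate_le_sum_deficit[OF e_in_E t_less] by (auto intro: knapsack_cover_antimono)
qed

text \<open>From rate \<open>1\<close> on, the kernel mass of \<open>e\<close> pays for the term \<open>k e\<close> of \<open>position_bound\<close>.\<close>

definition hitting_time :: "'v set \<Rightarrow> ('v \<Rightarrow> real) \<Rightarrow> nat" where
  "hitting_time e \<alpha> =
     (LEAST t. card V \<le> t \<or> 1 \<le> rate e t \<and> k e \<le> card {v \<in> e. \<alpha> v \<le> mass v t})"

definition position_bound :: "'v set \<Rightarrow> nat \<Rightarrow> ('v \<Rightarrow> real) \<Rightarrow> nat" where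
  "position_bound e t \<alpha> =
     (if t < card V then k e + card {w \<in> V - e. \<alpha> w \<le> mass w t} else card V)"

lemma hitting_time_le: "hitting_time e \<alpha> \<le> card V"
  unfolding hitting_time_def by (rule Least_le) simp

lemma hitting_time_less_cardD:
  assumes "hitting_time e \<alpha> < card V"
  shows "1 \<le> rate e (hitting_time e \<alpha>)" "k e \<le> card {v \<in> e. \<alpha> v \<le> mass v (hitting_time e \<alpha>)}"
proof -
  let ?Q = "\<lambda>t. card V \<le> t \<or> 1 \<le> rate e t \<and> k e \<le> card {v \<in> e. \<alpha> v \<le> mass v t}"
  have "?Q (hitting_time e \<alpha>)"
    unfolding hitting_time_def by (rule LeastI[of ?Q "card V"]) simp
  with assms show "1 \<le> rate e (hitting_time e \<alpha>)"
    "k e \<le> card {v \<in> e. \<alpha> v \<le> mass v (hitting_time e \<alpha>)}"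
    by simp_all
qed

lemma less_hitting_timeD:
  "t < hitting_time e \<alpha> \<Longrightarrow> 1 \<le> rate e t \<Longrightarrow> card {v \<in> e. \<alpha> v \<le> mass v t} < k e"
  unfolding hitting_time_def by (drule not_less_Least) simp

lemma hitting_time_restrict: "hitting_time e \<alpha> = hitting_time e (restrict \<alpha> e)"
  unfolding hitting_time_def by (simp cong: conj_cong)

lemma position_bound_restrict: "position_bound e t \<alpha> = position_bound e t (restrict \<alpha> (V - e))"
  unfolding position_bound_def by (simp cong: conj_cong)

lemma hitting_time_measurable:
  assumes e_in_E: "e \<in> E"
  shows "hitting_time e \<in> measurable (uniform_thresholds V) (count_space UNIV)"
proof -
  note [measurable] = measurable_card_thresholds_le[OF edge_props(2,1)[OF e_in_E]]
  show ?thesis unfolding hitting_time_def by measurable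
qed

lemma card_outside_measurable:
  "(\<lambda>\<alpha>. card {w \<in> V - e. \<alpha> w \<le> mass w t}) \<in> measurable (uniform_thresholds V) (count_space UNIV)"
  using finite_V by (intro measurable_card_thresholds_le) auto

lemma position_bound_measurable:
  "position_bound e t \<in> measurable (uniform_thresholds V) (count_space UNIV)"
proof -
  note [measurable] = card_outside_measurable
  show ?thesis unfolding position_bound_def by measurable
qed

lemma rate_0_le: "e \<in> E \<Longrightarrow> rate e 0 \<le> 0"
  using edge_value_ge_1[of e] \<beta>_ge_1 by (simp add: rate_def mult_nonneg_nonpos ln_div)

theorem cover_time_le_position_bound:
  assumes e_in_E: "e \<in> E" and \<sigma>_sorted: "\<sigma> \<in> sorted_orderings V (alpha_point V \<beta> x \<alpha>)"
  shows "cover_time k \<sigma> e \<le> position_bound e (hitting_time e \<alpha>) \<alpha>"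
proof (cases "hitting_time e \<alpha> < card V")
  case True
  define t where "t = hitting_time e \<alpha>"
  have "1 \<le> rate e t" "k e \<le> card {v \<in> e. \<alpha> v \<le> mass v t}"
    using hitting_time_less_cardD[OF True] by (simp_all add: t_def)
  moreover from this have "1 \<le> t"
    using rate_0_le[OF e_in_E] by (cases t) auto
  then have "{v \<in> I. alpha_point V \<beta> x \<alpha> v \<le> enat t} = {v \<in> I. \<alpha> v \<le> mass v t}" if "I \<subseteq> V" for I
    using alpha_point_le_iff that by blast
  ultimately show ?thesis
    using sorted_cover_time_le[OF finite_V edge_props(1)[OF e_in_E] \<sigma>_sorted, of k "enat t"]
      edge_props(1)[OF e_in_E] True
    by (simp add: position_bound_def t_def del: Diff_iff)
next
  case False
  have "\<sigma> \<in> orderings V" using \<sigma>_sorted by (simp add: sorted_orderings_def)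
  then show ?thesis
    using False edge_props[OF e_in_E] by (simp add: position_bound_def cover_time_le_card)
qed

lemma nn_integral_position_bound_le:
  assumes e_in_E: "e \<in> E" and t_rate: "t \<le> card V" "t < card V \<Longrightarrow> 1 \<le> rate e t"
  shows "(\<integral>\<^sup>+\<alpha>. of_nat (position_bound e t \<alpha>) \<partial>uniform_thresholds V) \<le> ennreal (\<beta> * real t)"
proof (cases "t < card V")
  case True
  interpret prob_space "uniform_thresholds V"
    by (rule prob_space_uniform_thresholds)
  let ?outside = "\<Sum>w\<in>V - e. min 1 (mass w t)"
  note [measurable] = card_outside_measurable
  have "real (k e) \<le> (\<Sum>v\<in>e. min 1 (mass v t))"
    using knapsack_cover_mass[OF e_in_E True] edge_props[OF e_in_E] t_rate(2)[OF True] mass_nonneg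
    by (intro knapsack_cover_sum_min_ge) auto
  then have "real (k e) + ?outside \<le> (\<Sum>v\<in>V. min 1 (mass v t))"
    using sum.subset_diff[OF edge_props(1)[OF e_in_E] finite_V, of "\<lambda>v. min 1 (mass v t)"] by simp
  also have "\<dots> \<le> (\<Sum>v\<in>V. mass v t)" by (intro sum_mono) simp
  also have "\<dots> \<le> \<beta> * real t" by (rule sum_mass_le)
  finally have budget: "real (k e) + ?outside \<le> \<beta> * real t" .
  have "(\<integral>\<^sup>+\<alpha>. of_nat (position_bound e t \<alpha>) \<partial>uniform_thresholds V)
      = of_nat (k e) + (\<integral>\<^sup>+\<alpha>. of_nat (card {w \<in> V - e. \<alpha> w \<le> mass w t}) \<partial>uniform_thresholds V)"
    using True by (simp add: position_bound_def nn_integral_add emeasure_space_1 del: Diff_iff)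
  also have "\<dots> = ennreal (real (k e) + ?outside)"
    using finite_V mass_nonneg
    by (subst nn_integral_card_thresholds_le)
      (auto simp: ennreal_of_nat_eq_real_of_nat intro!: ennreal_plus[symmetric] sum_nonneg)
  also have "\<dots> \<le> ennreal (\<beta> * real t)" using budget by (rule ennreal_leI)
  finally show ?thesis .
next
  case False
  interpret prob_space "uniform_thresholds V"
    by (rule prob_space_uniform_thresholds)
  have "real t \<le> \<beta> * real t" using mult_right_mono[OF \<beta>_ge_1, of "real t"] by simp
  then show ?thesis
    using False t_rate
    by (simp add: position_bound_def emeasure_space_1 ennreal_of_nat_eq_real_of_nat ennreal_leI)
qed

lemma nn_integral_position_bound_hitting_time_le:
  assumes e_in_E: "e \<in> E"
  shows "(\<integral>\<^sup>+\<alpha>. of_nat (position_bound e (hitting_time e \<alpha>) \<alpha>) \<partial>uniform_thresholds V)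
    \<le> ennreal \<beta> * (\<integral>\<^sup>+\<alpha>. of_nat (hitting_time e \<alpha>) \<partial>uniform_thresholds V)"
proof -
  interpret product_prob_space "\<lambda>_. uniform_measure lborel {0..1 :: real}" V
    by (intro product_prob_spaceI prob_space_uniform_unit)
  note [measurable] = hitting_time_measurable[OF e_in_E] position_bound_measurable
  have "(\<integral>\<^sup>+\<alpha>. of_nat (position_bound e (hitting_time e \<alpha>) \<alpha>) \<partial>uniform_thresholds V)
      = (\<integral>\<^sup>+\<alpha>. (\<integral>\<^sup>+\<alpha>'. of_nat (position_bound e (hitting_time e \<alpha>) \<alpha>') \<partial>uniform_thresholds V)
          \<partial>uniform_thresholds V)"
  proof (rule nn_integral_PiM_independent_time[OF finite_V edge_props(1)[OF e_in_E]])
    show "hitting_time e \<in> measurable (uniform_thresholds V) (count_space UNIV)"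
      "(\<lambda>\<alpha>. of_nat (position_bound e t \<alpha>)) \<in> borel_measurable (uniform_thresholds V)" for t
      by measurable
    show "hitting_time e \<alpha> = hitting_time e (restrict \<alpha> e)"
      "of_nat (position_bound e t \<alpha>) = of_nat (position_bound e t (restrict \<alpha> (V - e)))" for t \<alpha>
      using hitting_time_restrict position_bound_restrict by metis+
  qed
  also have "\<dots> \<le> (\<integral>\<^sup>+\<alpha>. ennreal \<beta> * of_nat (hitting_time e \<alpha>) \<partial>uniform_thresholds V)"
  proof (rule nn_integral_mono)
    fix \<alpha>
    have "(\<integral>\<^sup>+\<alpha>'. of_nat (position_bound e (hitting_time e \<alpha>) \<alpha>') \<partial>uniform_thresholds V)
        \<le> ennreal (\<beta> * real (hitting_time e \<alpha>))"
      using e_in_E hitting_time_le hitting_time_less_cardD(1)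
      by (rule nn_integral_position_bound_le)
    then show "(\<integral>\<^sup>+\<alpha>'. of_nat (position_bound e (hitting_time e \<alpha>) \<alpha>') \<partial>uniform_thresholds V)
        \<le> ennreal \<beta> * of_nat (hitting_time e \<alpha>)"
      using \<beta>_ge_1 by (simp add: ennreal_mult' ennreal_of_nat_eq_real_of_nat)
  qed
  also have "\<dots> = ennreal \<beta> * (\<integral>\<^sup>+\<alpha>. of_nat (hitting_time e \<alpha>) \<partial>uniform_thresholds V)"
    by (rule nn_integral_cmult) measurable
  finally show ?thesis .
qed

lemma emeasure_less_hitting_time_le:
  assumes tail: "tail_bound_function P" "antimono_on {1..} P" and e_in_E: "e \<in> E"
    and t_less: "t < card V"
  shows "emeasure (uniform_thresholds V) {\<alpha> \<in> space (uniform_thresholds V). t < hitting_time e \<alpha>}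
    \<le> ennreal (tail_extension P (rate e t))"
proof (cases "rate e t < 1")
  case True
  interpret prob_space "uniform_thresholds V"
    by (rule prob_space_uniform_thresholds)
  show ?thesis using True by (simp add: tail_extension_def emeasure_le_1)
next
  case False
  note [measurable] = measurable_card_thresholds_le[OF edge_props(2,1)[OF e_in_E]]
  have "emeasure (uniform_thresholds V) {\<alpha> \<in> space (uniform_thresholds V). t < hitting_time e \<alpha>}
      \<le> emeasure (uniform_thresholds V)
          {\<alpha> \<in> space (uniform_thresholds V). card {v \<in> e. \<alpha> v \<le> mass v t} < k e}"
    using False by (intro emeasure_mono) (auto dest: less_hitting_timeD)
  also have "\<dots> = ennreal (bernoulli_tail (\<lambda>v. min 1 (mass v t)) e (k e))"
    using finite_V edge_props[OF e_in_E] mass_nonneg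
    by (intro emeasure_card_thresholds_le_less) auto
  also have "\<dots> \<le> ennreal (P (rate e t))"
    using tail knapsack_cover_mass[OF e_in_E t_less] edge_props[OF e_in_E] mass_nonneg False
    by (intro ennreal_leI knapsack_cover_bernoulli_tail_le) auto
  finally show ?thesis using False by (simp add: tail_extension_def)
qed

lemma nn_integral_hitting_time_le:
  assumes tail: "tail_bound_function P" "antimono_on {1..} P" "P 1 \<le> 1" and e_in_E: "e \<in> E"
  shows "(\<integral>\<^sup>+\<alpha>. of_nat (hitting_time e \<alpha>) \<partial>uniform_thresholds V)
    \<le> ennreal (edge_value e) * kernel_r P \<beta>"
proof -
  let ?later = "\<lambda>t. {\<alpha> \<in> space (uniform_thresholds V). t < hitting_time e \<alpha>}"
  have "(\<integral>\<^sup>+\<alpha>. of_nat (hitting_time e \<alpha>) \<partial>uniform_thresholds V)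
      = (\<Sum>t. emeasure (uniform_thresholds V) (?later t))"
    using e_in_E by (intro nn_integral_nat_function hitting_time_measurable)
  also have "\<dots> = (\<Sum>t<card V. emeasure (uniform_thresholds V) (?later t))"
  proof (rule suminf_finite)
    fix t assume "t \<notin> {..<card V}"
    then have "\<not> t < hitting_time e \<alpha>" for \<alpha> using hitting_time_le[of e \<alpha>] by simp
    then show "emeasure (uniform_thresholds V) (?later t) = 0" by simp
  qed simp
  also have "\<dots> \<le> (\<Sum>t<card V. ennreal (tail_extension P (rate e t)))"
    using tail e_in_E by (intro sum_mono emeasure_less_hitting_time_le) auto
  also have "\<dots> \<le> ennreal (edge_value e) * kernel_r P \<beta>"
    unfolding rate_def using tail \<beta>_ge_1 edge_value_ge_1[OF e_in_E]
    by (intro sum_tail_extension_le_kernel_r) auto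
  finally show ?thesis .
qed

lemma sum_edge_value: "(\<Sum>e\<in>E. ennreal (edge_value e)) = ennreal (lp_value V E u)"
  unfolding lp_value_def edge_value_def using feasible
  by (intro sum_ennreal sum_nonneg) (auto simp: lp_feasible_def)

theorem expected_cost_le:
  assumes tail: "tail_bound_function P" "antimono_on {1..} P" "P 1 \<le> 1"
  shows "expected_cost V E k \<beta> x \<le> ennreal \<beta> * kernel_r P \<beta> * ennreal (lp_value V E u)"
proof -
  let ?bound = "\<lambda>e \<alpha>. position_bound e (hitting_time e \<alpha>) \<alpha>"
  have "expected_cost V E k \<beta> x \<le> (\<integral>\<^sup>+\<alpha>. (\<Sum>e\<in>E. of_nat (?bound e \<alpha>)) \<partial>uniform_thresholds V)"
    unfolding expected_cost_def
  proof (rule nn_integral_mono)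
    fix \<alpha> :: "'v \<Rightarrow> real"
    let ?S = "sorted_orderings V (alpha_point V \<beta> x \<alpha>)"
    have "(of_nat (gmssc_cost E k \<sigma>) :: ennreal) \<le> (\<Sum>e\<in>E. of_nat (?bound e \<alpha>))" if "\<sigma> \<in> ?S" for \<sigma>
      unfolding gmssc_cost_def of_nat_sum
      using that by (intro sum_mono of_nat_mono cover_time_le_position_bound)
    then have "(\<integral>\<^sup>+\<sigma>. of_nat (gmssc_cost E k \<sigma>) \<partial>measure_pmf (pmf_of_set ?S))
        \<le> (\<integral>\<^sup>+\<sigma>. (\<Sum>e\<in>E. of_nat (?bound e \<alpha>)) \<partial>measure_pmf (pmf_of_set ?S))"
      using sorted_orderings_nonempty[OF finite_V] finite_sorted_orderings[OF finite_V]
      by (intro nn_integral_mono_AE) (simp add: AE_measure_pmf_iff)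
    then show "(\<integral>\<^sup>+\<sigma>. of_nat (gmssc_cost E k \<sigma>) \<partial>measure_pmf (pmf_of_set ?S))
        \<le> (\<Sum>e\<in>E. of_nat (?bound e \<alpha>))"
      by (simp add: measure_pmf.emeasure_space_1)
  qed
  also have "\<dots> = (\<Sum>e\<in>E. \<integral>\<^sup>+\<alpha>. of_nat (?bound e \<alpha>) \<partial>uniform_thresholds V)"
  proof (rule nn_integral_sum)
    fix e assume "e \<in> E"
    note [measurable] = hitting_time_measurable[OF this] position_bound_measurable
    show "(\<lambda>\<alpha>. of_nat (?bound e \<alpha>)) \<in> borel_measurable (uniform_thresholds V)"
      by measurable
  qed
  also have "\<dots> \<le> (\<Sum>e\<in>E. ennreal \<beta> * (ennreal (edge_value e) * kernel_r P \<beta>))"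
    using tail
    by (intro sum_mono order_trans[OF nn_integral_position_bound_hitting_time_le] mult_left_mono
        nn_integral_hitting_time_le) auto
  also have "\<dots> = ennreal \<beta> * kernel_r P \<beta> * ennreal (lp_value V E u)"
    unfolding sum_edge_value[symmetric] sum_distrib_left by (simp only: mult_ac)
  finally show ?thesis .
qed

end

theorem approx_ratio_le_kernel_r:
  assumes tail: "tail_bound_function P" "antimono_on {1..} P" "P 1 \<le> 1" and \<beta>_ge_1: "1 \<le> \<beta>"
  shows "approx_ratio TYPE('v) \<beta> \<le> ennreal \<beta> * kernel_r P \<beta>"
  unfolding approx_ratio_def
proof (rule Sup_least, clarify)
  fix V :: "'v set" and E k x u
  assume inst: "gmssc_instance V E k" and opt: "lp_optimal V E k x u"
  interpret kernel_rounding V E k x u \<beta>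
    using inst opt \<beta>_ge_1 by unfold_locales (simp_all add: lp_optimal_def)
  let ?opt = "of_nat (gmssc_opt V E k) :: ennreal"
  have "ennreal (lp_value V E u) \<le> ?opt"
    using lp_optimal_le_gmssc_opt[OF inst opt]
    by (simp add: ennreal_of_nat_eq_real_of_nat ennreal_leI)
  then have bound: "expected_cost V E k \<beta> x \<le> ennreal \<beta> * kernel_r P \<beta> * ?opt"
    using expected_cost_le[OF tail] by (meson mult_left_mono order_trans zero_le)
  show "expected_cost V E k \<beta> x / ?opt \<le> ennreal \<beta> * kernel_r P \<beta>"
  proof (cases "gmssc_opt V E k = 0")
    case True
    then show ?thesis using bound by simp
  next
    case False
    have "expected_cost V E k \<beta> x / ?opt \<le> ennreal \<beta> * kernel_r P \<beta> * ?opt / ?opt"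
      using bound by (rule divide_right_mono_ennreal)
    also have "\<dots> = ennreal \<beta> * kernel_r P \<beta>"
      using False by (simp add: ennreal_mult_divide_eq)
    finally show ?thesis .
  qed
qed

section \<open>The guarantee for the explicit bounds\<close>

lemma nn_integral_exp_atLeast_1:
  assumes "0 < (c :: real)"
  shows "(\<integral>\<^sup>+x\<in>{1..}. ennreal (exp (- (c * (x - 1)))) \<partial>lborel) = ennreal (1 / c)"
proof -
  have "(\<integral>\<^sup>+x\<in>{1..}. ennreal (exp (- (c * (x - 1)))) \<partial>lborel)
      = ennreal (0 - (- (exp (- (c * (1 - 1))) / c)))"
  proof (rule nn_integral_FTC_atLeast[where F = "\<lambda>x. - (exp (- (c * (x - 1))) / c)" and T = 0])
    show "DERIV (\<lambda>x. - (exp (- (c * (x - 1))) / c)) x :> exp (- (c * (x - 1)))" for x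
      using assms by (auto intro!: derivative_eq_intros)
    show "((\<lambda>x. - (exp (- (c * (x - 1))) / c)) \<longlongrightarrow> 0) at_top"
      using assms by real_asymp
  qed auto
  then show ?thesis by simp
qed

theorem kernel_r_exp_sum:
  assumes a_nonneg: "\<And>j. j < m \<Longrightarrow> 0 \<le> a j" and \<beta>_gt_1: "1 < \<beta>"
  shows "kernel_r (\<lambda>x. \<Sum>j<m. a j * exp (- (real (Suc j) * (x - 1)))) \<beta>
    = ennreal (exp (1 / \<beta>) * (1 + (\<Sum>j<m. a j / (\<beta> * real (Suc j) - 1))))"
proof -
  define c where "c j = real (Suc j) - 1 / \<beta>" for j
  have "1 / \<beta> < 1" using \<beta>_gt_1 by simp
  then have c_pos: "0 < c j" for j by (simp add: c_def)
  have "(\<Sum>j<m. a j * exp (- (real (Suc j) * (x - 1)))) * exp ((x - 1) / \<beta>)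
      = (\<Sum>j<m. a j * exp (- (c j * (x - 1))))" for x
    unfolding sum_distrib_right mult.assoc exp_add[symmetric]
    by (simp add: c_def left_diff_distrib)
  then have "ennreal ((\<Sum>j<m. a j * exp (- (real (Suc j) * (x - 1)))) * exp ((x - 1) / \<beta>))
      = (\<Sum>j<m. ennreal (a j) * ennreal (exp (- (c j * (x - 1)))))" for x
    using a_nonneg by (simp only:) (subst sum_ennreal[symmetric], auto simp: ennreal_mult')
  then have "(\<integral>\<^sup>+x\<in>{1..}. ennreal ((\<Sum>j<m. a j * exp (- (real (Suc j) * (x - 1))))
        * exp ((x - 1) / \<beta>)) \<partial>lborel)
      = (\<integral>\<^sup>+x. (\<Sum>j<m. ennreal (a j) * (ennreal (exp (- (c j * (x - 1)))) * indicator {1..} x)) \<partial>lborel)"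
    by (simp only: sum_distrib_right mult.assoc)
  also have "\<dots> = (\<Sum>j<m. ennreal (a j) * ennreal (1 / c j))"
    using c_pos by (subst nn_integral_sum)
      (simp_all add: nn_integral_cmult nn_integral_exp_atLeast_1)
  also have "\<dots> = ennreal (\<Sum>j<m. a j / c j)"
    using a_nonneg c_pos
    by (subst sum_ennreal[symmetric]) (simp_all add: less_imp_le flip: ennreal_mult')
  finally have "kernel_r (\<lambda>x. \<Sum>j<m. a j * exp (- (real (Suc j) * (x - 1)))) \<beta>
      = ennreal (exp (1 / \<beta>)) * (1 + ennreal (1 / \<beta>) * ennreal (\<Sum>j<m. a j / c j))"
    by (simp only: kernel_r_def)
  also have "1 + ennreal (1 / \<beta>) * ennreal (\<Sum>j<m. a j / c j) = ennreal (1 + 1 / \<beta> * (\<Sum>j<m. a j / c j))"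
  proof -
    have "0 \<le> (\<Sum>j<m. a j / c j)"
      using a_nonneg c_pos by (auto intro!: sum_nonneg divide_nonneg_pos)
    then show ?thesis
      using \<beta>_gt_1 by (simp add: ennreal_mult del: times_divide_eq_left)
  qed
  also have "ennreal (exp (1 / \<beta>)) * \<dots> = ennreal (exp (1 / \<beta>) * (1 + 1 / \<beta> * (\<Sum>j<m. a j / c j)))"
    by (simp add: ennreal_mult')
  also have "1 / \<beta> * (\<Sum>j<m. a j / c j) = (\<Sum>j<m. a j / (\<beta> * real (Suc j) - 1))"
    unfolding sum_distrib_left using \<beta>_gt_1
    by (intro sum.cong refl) (simp add: c_def right_diff_distrib)
  finally show ?thesis .
qed

theorem kernel_r_tail_half_exp:
  assumes "1 < \<beta>"
  shows "ennreal \<beta> * kernel_r tail_half_exp \<beta>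
    = ennreal (\<beta> * (2 * \<beta> - 1) * exp (1 / \<beta>) / (2 * \<beta> - 2))"
proof -
  have "tail_half_exp = (\<lambda>x. \<Sum>j<1. 1 / 2 * exp (- (real (Suc j) * (x - 1))))"
    by (simp add: fun_eq_iff tail_half_exp_def)
  then have "kernel_r tail_half_exp \<beta> = ennreal (exp (1 / \<beta>) * (1 + 1 / 2 / (\<beta> - 1)))"
    using kernel_r_exp_sum[of 1 "\<lambda>_. 1 / 2" \<beta>] assms by simp
  moreover have "1 + 1 / 2 / (\<beta> - 1) = (2 * \<beta> - 1) / (2 * \<beta> - 2)"
    using assms by (simp add: field_simps)
  ultimately show ?thesis
    using assms by (simp add: mult_ac flip: ennreal_mult')
qed

subsection \<open>Numerical values\<close>

lemma exp_le_taylor: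
  fixes x :: real
  assumes "0 \<le> x" "x \<le> 1"
  shows "exp x \<le> (\<Sum>m<n. x ^ m / fact m) + 3 / fact n * x ^ n"
proof -
  obtain t where t_remainder: "\<bar>t\<bar> \<le> \<bar>x\<bar>" "exp x = (\<Sum>m<n. x ^ m / fact m) + exp t / fact n * x ^ n"
    using Maclaurin_exp_le by blast
  have "exp t \<le> exp 1" using t_remainder assms by auto
  also have "\<dots> \<le> 3" by (rule exp_le)
  finally have "exp t / fact n * x ^ n \<le> 3 / fact n * x ^ n"
    using assms by (intro mult_right_mono divide_right_mono) auto
  then show ?thesis using t_remainder by simp
qed

lemma ln_2_ge: "0.69314718 \<le> ln (2 :: real)"
proof -
  have "exp (0.69314718 :: real) \<le> (\<Sum>m<13. 0.69314718 ^ m / fact m) + 3 / fact 13 * 0.69314718 ^ 13"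
    by (rule exp_le_taylor) auto
  also have "\<dots> \<le> 2"
    by (simp add: eval_nat_numeral)
  finally show ?thesis by (subst ln_ge_iff) simp_all
qed

lemma exp_inverse_2191_le: "exp (1 / 2.191 :: real) \<le> 1.578402"
proof -
  have "exp (1 / 2.191 :: real) \<le> (\<Sum>m<9. (1 / 2.191) ^ m / fact m) + 3 / fact 9 * (1 / 2.191) ^ 9"
    by (rule exp_le_taylor) auto
  also have "\<dots> \<le> 1.578402"
    by (simp add: eval_nat_numeral)
  finally show ?thesis .
qed

lemma exp_inverse_20715_le: "exp (1 / 2.0715 :: real) \<le> 1.6205117177"
proof -
  have "exp (1 / 2.0715 :: real) \<le> (\<Sum>m<13. (1 / 2.0715) ^ m / fact m) + 3 / fact 13 * (1 / 2.0715) ^ 13"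
    by (rule exp_le_taylor) auto
  also have "\<dots> \<le> 1.6205117177"
    by (simp add: eval_nat_numeral)
  finally show ?thesis .
qed

lemma half_exp_ratio_2191_le:
  "(2.191 :: real) * (2 * 2.191 - 1) * exp (1 / 2.191) / (2 * 2.191 - 2) \<le> 4.9102"
  using exp_inverse_2191_le by simp

text \<open>For \<open>c = 0.30685282\<close>, which is an upper bound for \<open>1 - ln 2\<close>, these are the coefficients of
  the bound on \<open>exp (c w)\<close> in \<open>exp_le_taylor\<close>; the last one is that of the remainder term.\<close>

definition double_exp_coeff :: "nat \<Rightarrow> real" where
  "double_exp_coeff j = 0.30685282 ^ j / fact j * (if j = 7 then 3 else 1)"

lemma tail_double_exp_le_exp_sum:
  assumes "1 \<le> x"
  shows "tail_double_exp x \<le> (\<Sum>j<8. exp (- 1) * double_exp_coeff j * exp (- (real (Suc j) * (x - 1))))"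
proof -
  define c :: real where "c = 0.30685282"
  define w where "w = exp (1 - x)"
  have w_unit: "0 < w" "w \<le> 1" using assms by (auto simp: w_def)
  have "(1 - ln 2) * w \<le> c * w"
    using ln_2_ge w_unit by (intro mult_right_mono) (auto simp: c_def)
  then have "exp ((1 - ln 2) * w) \<le> exp (c * w)" by simp
  also have "\<dots> \<le> (\<Sum>m<7. (c * w) ^ m / fact m) + 3 / fact 7 * (c * w) ^ 7"
    using w_unit by (intro exp_le_taylor) (auto simp: c_def intro: mult_le_one)
  also have "\<dots> = (\<Sum>j<8. double_exp_coeff j * w ^ j)"
    by (simp add: double_exp_coeff_def c_def power_mult_distrib eval_nat_numeral)
  finally have exp_le: "exp ((1 - ln 2) * w) \<le> (\<Sum>j<8. double_exp_coeff j * w ^ j)" .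
  have "exp (- 1) * w * exp ((1 - ln 2) * w) = exp ((- 1 + (1 - x)) + (1 - ln 2) * w)"
    by (simp only: w_def exp_add)
  then have "tail_double_exp x = exp (- 1) * w * exp ((1 - ln 2) * w)"
    by (simp add: tail_double_exp_eq w_def)
  also have "\<dots> \<le> exp (- 1) * w * (\<Sum>j<8. double_exp_coeff j * w ^ j)"
    using w_unit exp_le by (intro mult_left_mono) auto
  also have "\<dots> = (\<Sum>j<8. exp (- 1) * double_exp_coeff j * w ^ Suc j)"
    by (simp only: sum_distrib_left power_Suc mult_ac)
  also have "\<dots> = (\<Sum>j<8. exp (- 1) * double_exp_coeff j * exp (- (real (Suc j) * (x - 1))))"
    unfolding w_def exp_of_nat_mult[symmetric] by (simp add: right_diff_distrib)
  finally show ?thesis .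
qed

theorem kernel_r_tail_double_exp_le:
  "ennreal 2.0715 * kernel_r tail_double_exp 2.0715 \<le> ennreal 4.642"
proof -
  define s :: real where "s = (\<Sum>j<8. double_exp_coeff j / (2.0715 * real (Suc j) - 1))"
  have coeff_nonneg: "0 \<le> double_exp_coeff j" for j by (simp add: double_exp_coeff_def)
  have "kernel_r tail_double_exp 2.0715
      \<le> kernel_r (\<lambda>x. \<Sum>j<8. exp (- 1) * double_exp_coeff j * exp (- (real (Suc j) * (x - 1)))) 2.0715"
    by (intro kernel_r_mono tail_double_exp_le_exp_sum)
  also have "\<dots> = ennreal (exp (1 / 2.0715)
      * (1 + (\<Sum>j<8. exp (- 1) * double_exp_coeff j / (2.0715 * real (Suc j) - 1))))"
    using coeff_nonneg by (intro kernel_r_exp_sum) auto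
  also have "(\<Sum>j<8. exp (- 1) * double_exp_coeff j / (2.0715 * real (Suc j) - 1)) = exp (- 1) * s"
    unfolding s_def sum_distrib_left times_divide_eq_right ..
  also have "ennreal (exp (1 / 2.0715) * (1 + exp (- 1) * s)) \<le> ennreal (4.642 / 2.0715)"
  proof (rule ennreal_leI)
    have s_bounds: "0 \<le> s" "s \<le> 1.0406327"
      by (simp_all add: s_def double_exp_coeff_def eval_nat_numeral)
    have "2.718281828 \<le> exp (1 :: real)"
      using abs_le_D2[OF e_approx_32] by simp
    then have "exp (- 1 :: real) \<le> 1 / 2.718281828"
      by (simp add: exp_minus field_simps)
    then have "exp (- 1) * s \<le> 1 / 2.718281828 * 1.0406327"
      using s_bounds by (intro mult_mono) auto
    then have "exp (1 / 2.0715) * (1 + exp (- 1) * s)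
        \<le> 1.6205117177 * (1 + 1 / 2.718281828 * 1.0406327)"
      using exp_inverse_20715_le s_bounds by (intro mult_mono) auto
    then show "exp (1 / 2.0715) * (1 + exp (- 1) * s) \<le> 4.642 / 2.0715" by simp
  qed
  finally have "ennreal 2.0715 * kernel_r tail_double_exp 2.0715
      \<le> ennreal 2.0715 * ennreal (4.642 / 2.0715)"
    by (intro mult_left_mono) auto
  also have "\<dots> = ennreal 4.642" by (simp flip: ennreal_mult')
  finally show ?thesis .
qed

subsection \<open>The approximation ratios\<close>

corollary approx_ratio_le_half_exp:
  assumes "1 < \<beta>"
  shows "approx_ratio TYPE('v) \<beta> \<le> ennreal (\<beta> * (2 * \<beta> - 1) * exp (1 / \<beta>) / (2 * \<beta> - 2))"
proof -
  have "approx_ratio TYPE('v) \<beta> \<le> ennreal \<beta> * kernel_r tail_half_exp \<beta>"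
    using tail_bound_function_tail_half_exp antimono_on_tail_half_exp assms
    by (intro approx_ratio_le_kernel_r) (auto simp: tail_half_exp_def)
  then show ?thesis by (simp only: kernel_r_tail_half_exp[OF assms])
qed

corollary approx_ratio_le_double_exp:
  assumes "1 \<le> \<beta>"
  shows "approx_ratio TYPE('v) \<beta> \<le> ennreal \<beta> * kernel_r tail_double_exp \<beta>"
proof (rule approx_ratio_le_kernel_r[OF tail_bound_function_tail_double_exp
      antimono_on_tail_double_exp _ assms])
  show "tail_double_exp 1 \<le> 1" using ln2_ge_two_thirds by (simp add: tail_double_exp_eq)
qed

theorem theorem8:
  shows "(\<forall>(P :: real \<Rightarrow> real) (\<beta> :: real).
            tail_bound_function P \<and> convex_on {1..} P \<and> antimono_on {1..} P \<and> P 1 \<le> 1 \<and> 1 \<le> \<beta>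
            \<longrightarrow> approx_ratio TYPE('v) \<beta> \<le> ennreal \<beta> * kernel_r P \<beta>)
       \<and> (\<forall>\<beta> > (1 :: real).
            ennreal \<beta> * kernel_r tail_half_exp \<beta>
              = ennreal (\<beta> * (2 * \<beta> - 1) * exp (1 / \<beta>) / (2 * \<beta> - 2))
            \<and> approx_ratio TYPE('v) \<beta>
                \<le> ennreal (\<beta> * (2 * \<beta> - 1) * exp (1 / \<beta>) / (2 * \<beta> - 2)))
       \<and> (2.191 :: real) * (2 * 2.191 - 1) * exp (1 / 2.191) / (2 * 2.191 - 2) \<le> 4.9102
       \<and> approx_ratio TYPE('v) 2.191 \<le> ennreal 4.9102
       \<and> ennreal 2.0715 * kernel_r tail_double_exp 2.0715 \<le> ennreal 4.642
       \<and> approx_ratio TYPE('v) 2.0715 \<le> ennreal 4.642"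
proof (intro conjI allI impI)
  fix P :: "real \<Rightarrow> real" and \<beta> :: real
  assume "tail_bound_function P \<and> convex_on {1..} P \<and> antimono_on {1..} P \<and> P 1 \<le> 1 \<and> 1 \<le> \<beta>"
  then show "approx_ratio TYPE('v) \<beta> \<le> ennreal \<beta> * kernel_r P \<beta>"
    by (intro approx_ratio_le_kernel_r) auto
next
  fix \<beta> :: real assume \<beta>: "1 < \<beta>"
  show "ennreal \<beta> * kernel_r tail_half_exp \<beta> = ennreal (\<beta> * (2 * \<beta> - 1) * exp (1 / \<beta>) / (2 * \<beta> - 2))"
    using \<beta> by (rule kernel_r_tail_half_exp)
  show "approx_ratio TYPE('v) \<beta> \<le> ennreal (\<beta> * (2 * \<beta> - 1) * exp (1 / \<beta>) / (2 * \<beta> - 2))"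
    using \<beta> by (rule approx_ratio_le_half_exp)
next
  show "(2.191 :: real) * (2 * 2.191 - 1) * exp (1 / 2.191) / (2 * 2.191 - 2) \<le> 4.9102"
    by (rule half_exp_ratio_2191_le)
  show "approx_ratio TYPE('v) 2.191 \<le> ennreal 4.9102"
    by (rule order_trans[OF approx_ratio_le_half_exp ennreal_leI[OF half_exp_ratio_2191_le]]) simp
  show "ennreal 2.0715 * kernel_r tail_double_exp 2.0715 \<le> ennreal 4.642"
    by (rule kernel_r_tail_double_exp_le)
  show "approx_ratio TYPE('v) 2.0715 \<le> ennreal 4.642"
    by (rule order_trans[OF approx_ratio_le_double_exp kernel_r_tail_double_exp_le]) simp
qed

end
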